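(* Let $n\ge 2$, let $\mathcal B(j_1,i_1)\mathcal B(j_2,i_2)\cdots\mathcal B(j_m,i_m)$ be an affine block of affine length $m\ge1$, let $w_a$ be the corresponding element of $W(\tilde A_n)$, and let $s\in S_n$. Then: <br>(1) either $sw_a$ is not a distinguished representative of $W(\tilde A_n)/W(A_n)$, and then $l(sw_a)=l(w_a)+1$ and $sw_a=w_a\sigma_v$ for some $v$, $1\le v\le n$; <br>(2) or $sw_a$ is a distinguished representative of $W(\tilde A_n)/W(A_n)$ and one of the following holds: <br>(a) $s=a_{n+1}$ and $h(j_1,i_1)=1$, and $a_{n+1}w_a$ reduces to the affine block $\mathcal B(j_2,i_2)\cdots\mathcal B(j_m,i_m)$ (which is $1$ if $m=1$); <br>(b) $s=a_{n+1}$ and $h(j_1,i_1)$ is extremal, and $a_{n+1}w_a$ is expressed by the affine block $a_{n+1}\mathcal B(j_1,i_1)\mathcal B(j_2,i_2)\cdots\mathcal B(j_m,i_m)$; <br>(c) otherwise, $sw_a$ is expressed by an affine block $\mathcal B(j'_1,i'_1)\mathcal B(j'_2,i'_2)\cdots\mathcal B(j'_m,i'_m)$, where the $2m$-tuples $(j_1,i_1,\dots,j_m,i_m)$ and $(j'_1,i'_1,\dots,j'_m,i'_m)$ differ in one and only one entry, say $j'_r\ne j_r$ or $i'_r\ne i_r$. If $l(sw_a)=l(w_a)+1$ then $j'_r=j_r-1$ or $i'_r=i_r+1$, while if $l(sw_a)=l(w_a)-1$ then $j'_r=j_r+1$ or $i'_r=i_r-1$.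
   Context: For $n\ge2$, $W(\tilde A_n)$ is the Coxeter group with generating set $S_n=\{\sigma_1,\dots,\sigma_n,a_{n+1}\}$ whose Coxeter graph is the cycle $\sigma_1-\sigma_2-\cdots-\sigma_n-a_{n+1}-\sigma_1$ (all edges of label 3). $W(A_n)$ is the parabolic subgroup generated by $\sigma_1,\dots,\sigma_n$; $l$ is the Coxeter length. A distinguished representative of $W(\tilde A_n)/W(A_n)$ is the unique element of minimal length in a coset $wW(A_n)$. Notation (words): $\lfloor i,j\rfloor=\sigma_i\sigma_{i+1}\cdots\sigma_j$ for $1\le i\le j\le n$, $\lfloor n+1,n\rfloor=1$; $\lceil i,j\rceil=\sigma_i\sigma_{i-1}\cdots\sigma_j$ for $n\ge i\ge j\ge1$, $\lceil 0,1\rceil=1$. For $1\le r\le n+1$, $0\le i\le n-1$: $h(r,i)=\lfloor r,n\rfloor\lceil i,1\rceil$ and $\mathcal B(r,i)=h(r,i)a_{n+1}$; in particular $\mathcal B(n+1,0)=a_{n+1}$. An element of $W(A_n)$ is extremal if both $\sigma_1$ and $\sigma_n$ appear in a (any) reduced expression of it. An affine block of affine length $m$ is an expression $\mathcal B(j_1,i_1)\cdots\mathcal B(j_m,i_m)$ where the integers $(j_s,i_s)_{1\le s\le m}$ satisfy the pairwise inequalities: (i) $1\le j_1\le n+1$ and $0\le i_1\le n-1$; (ii) for $2\le s\le m$, either $i_s=0$ and $j_s=1$, or $1\le i_s\le n-1$ and $1\le j_s\le n$; (iii) for $2\le s\le m$, $j_s\le j_{s-1}$ and $i_s\ge i_{s-1}$;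 (iv) for $2\le s\le m$, if $j_{s-1}>i_{s-1}+1$ then $j_s<j_{s-1}$; (v) for $2\le s\le m$, if $j_s>i_s+1$ then $i_s>i_{s-1}$. The empty block ($m=0$) expresses $1$. *)

theory Defs
  imports "HOL-Algebra.Generated_Groups"
begin

section \<open>Coxeter groups\<close>

text \<open>
  A Coxeter matrix \<open>M\<close> on a set \<open>S\<close> presents the group with generators \<open>S\<close> and relations
  \<open>(s t)^(M s t) = 1\<close>. Since \<open>M s s = 1\<close> makes every generator an involution, the group is the
  quotient of the free monoid on \<open>S\<close> by the congruence generated by these relations.
  The label infinity is encoded as \<open>M s t = 0\<close>, which yields a void relation.
\<close>

inductive cox_eq :: "'a set \<Rightarrow> ('a \<Rightarrow> 'a \<Rightarrow> nat) \<Rightarrow> 'a list \<Rightarrow> 'a list \<Rightarrow> bool"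
  for S :: "'a set" and M :: "'a \<Rightarrow> 'a \<Rightarrow> nat" where
  relator: "\<lbrakk>u \<in> lists S; v \<in> lists S; s \<in> S; t \<in> S\<rbrakk>
    \<Longrightarrow> cox_eq S M (u @ concat (replicate (M s t) [s, t]) @ v) (u @ v)"
| refl: "u \<in> lists S \<Longrightarrow> cox_eq S M u u"
| sym: "cox_eq S M u v \<Longrightarrow> cox_eq S M v u"
| trans: "\<lbrakk>cox_eq S M u v; cox_eq S M v w\<rbrakk> \<Longrightarrow> cox_eq S M u w"

definition cox_rel :: "'a set \<Rightarrow> ('a \<Rightarrow> 'a \<Rightarrow> nat) \<Rightarrow> ('a list \<times> 'a list) set" where
  "cox_rel S M = {(u, v). cox_eq S M u v}"

text \<open>The group element expressed by a word:\<close>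

definition cox_elem :: "'a set \<Rightarrow> ('a \<Rightarrow> 'a \<Rightarrow> nat) \<Rightarrow> 'a list \<Rightarrow> 'a list set" where
  "cox_elem S M u = cox_rel S M `` {u}"

definition cox_group :: "'a set \<Rightarrow> ('a \<Rightarrow> 'a \<Rightarrow> nat) \<Rightarrow> 'a list set monoid" where
  "cox_group S M =
    \<lparr>carrier = lists S // cox_rel S M,
     monoid.mult = (\<lambda>A B. \<Union>u\<in>A. \<Union>v\<in>B. cox_elem S M (u @ v)),
     one = cox_elem S M []\<rparr>"

definition cox_length :: "'a set \<Rightarrow> ('a \<Rightarrow> 'a \<Rightarrow> nat) \<Rightarrow> 'a list set \<Rightarrow> nat" where
  "cox_length S M w = (LEAST k. \<exists>u\<in>lists S. cox_elem S M u = w \<and> length u = k)"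

definition reduced_expression ::
    "'a set \<Rightarrow> ('a \<Rightarrow> 'a \<Rightarrow> nat) \<Rightarrow> 'a list \<Rightarrow> 'a list set \<Rightarrow> bool" where
  "reduced_expression S M u w \<longleftrightarrow>
    u \<in> lists S \<and> cox_elem S M u = w \<and> length u = cox_length S M w"

definition parabolic :: "'a set \<Rightarrow> ('a \<Rightarrow> 'a \<Rightarrow> nat) \<Rightarrow> 'a set \<Rightarrow> 'a list set set" where
  "parabolic S M J = generate (cox_group S M) ((\<lambda>s. cox_elem S M [s]) ` J)"

definition distinguished_rep ::
    "'a set \<Rightarrow> ('a \<Rightarrow> 'a \<Rightarrow> nat) \<Rightarrow> 'a set \<Rightarrow> 'a list set \<Rightarrow> bool" where
  "distinguished_rep S M J d \<longleftrightarrow>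
    d \<in> carrier (cox_group S M) \<and>
    (\<forall>x \<in> d <#\<^bsub>cox_group S M\<^esub> parabolic S M J. x \<noteq> d \<longrightarrow> cox_length S M d < cox_length S M x)"

section \<open>The affine Weyl group of type \<open>A\<close>\<close>

text \<open>
  The index \<open>k \<in> {1..n}\<close> stands for \<open>\<sigma>\<^sub>k\<close> and the index \<open>n + 1\<close> for \<open>a\<^sub>n\<^sub>+\<^sub>1\<close>, so that
  the Coxeter graph is the cycle \<open>1 - 2 - ... - n - (n + 1) - 1\<close>.
\<close>

definition aff_gens :: "nat \<Rightarrow> nat set" where
  "aff_gens n = {1..n+1}"

definition aff_adjacent :: "nat \<Rightarrow> nat \<Rightarrow> nat \<Rightarrow> bool" where
  "aff_adjacent n s t \<longleftrightarrow>
    t = s + 1 \<or> s = t + 1 \<or> (s = 1 \<and> t = n + 1) \<or> (s = n + 1 \<and> t = 1)"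

definition aff_matrix :: "nat \<Rightarrow> nat \<Rightarrow> nat \<Rightarrow> nat" where
  "aff_matrix n s t = (if s = t then 1 else if aff_adjacent n s t then 3 else 2)"

abbreviation aff_group :: "nat \<Rightarrow> nat list set monoid" where
  "aff_group n \<equiv> cox_group (aff_gens n) (aff_matrix n)"

abbreviation aff_elem :: "nat \<Rightarrow> nat list \<Rightarrow> nat list set" where
  "aff_elem n \<equiv> cox_elem (aff_gens n) (aff_matrix n)"

abbreviation aff_length :: "nat \<Rightarrow> nat list set \<Rightarrow> nat" where
  "aff_length n \<equiv> cox_length (aff_gens n) (aff_matrix n)"

text \<open>The subgroup \<open>W(A\<^sub>n)\<close>, and the distinguished representatives of its left cosets:\<close>

abbreviation fin_subgroup :: "nat \<Rightarrow> nat list set set" where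
  "fin_subgroup n \<equiv> parabolic (aff_gens n) (aff_matrix n) {1..n}"

abbreviation aff_distinguished :: "nat \<Rightarrow> nat list set \<Rightarrow> bool" where
  "aff_distinguished n \<equiv> distinguished_rep (aff_gens n) (aff_matrix n) {1..n}"

text \<open>
  The support of a reduced expression depends only on the element, so it is immaterial
  whether one or every reduced expression is considered here.
\<close>

definition extremal :: "nat \<Rightarrow> nat list set \<Rightarrow> bool" where
  "extremal n w \<longleftrightarrow> w \<in> fin_subgroup n \<and>
    (\<exists>u. reduced_expression (aff_gens n) (aff_matrix n) u w \<and> 1 \<in> set u \<and> n \<in> set u)"

section \<open>Affine blocks\<close>

text \<open>
  \<open>up_word i j\<close> is \<open>\<sigma>\<^sub>i \<sigma>\<^sub>i\<^sub>+\<^sub>1 ... \<sigma>\<^sub>j\<close> and \<open>down_word i j\<close> is \<open>\<sigma>\<^sub>i \<sigma>\<^sub>i\<^sub>-\<^sub>1 ... \<sigma>\<^sub>j\<close>;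
  in particular \<open>up_word (n + 1) n\<close> and \<open>down_word 0 1\<close> are empty.
\<close>

definition up_word :: "nat \<Rightarrow> nat \<Rightarrow> nat list" where
  "up_word i j = [i..<j+1]"

definition down_word :: "nat \<Rightarrow> nat \<Rightarrow> nat list" where
  "down_word i j = rev [j..<i+1]"

definition h_word :: "nat \<Rightarrow> nat \<Rightarrow> nat \<Rightarrow> nat list" where
  "h_word n r i = up_word r n @ down_word i 1"

definition B_word :: "nat \<Rightarrow> nat \<Rightarrow> nat \<Rightarrow> nat list" where
  "B_word n r i = h_word n r i @ [n+1]"

text \<open>
  The block \<open>B(j\<^sub>1,i\<^sub>1) ... B(j\<^sub>m,i\<^sub>m)\<close> is represented by the list of pairs \<open>(j\<^sub>s, i\<^sub>s)\<close>, whose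
  entries are accessed with the indices \<open>1, ..., m\<close>.
\<close>

definition jj :: "(nat \<times> nat) list \<Rightarrow> nat \<Rightarrow> nat" where
  "jj b s = fst (b ! (s - 1))"

definition ii :: "(nat \<times> nat) list \<Rightarrow> nat \<Rightarrow> nat" where
  "ii b s = snd (b ! (s - 1))"

definition block_word :: "nat \<Rightarrow> (nat \<times> nat) list \<Rightarrow> nat list" where
  "block_word n b = concat (map (\<lambda>(j, i). B_word n j i) b)"

definition affine_block :: "nat \<Rightarrow> (nat \<times> nat) list \<Rightarrow> bool" where
  "affine_block n b \<longleftrightarrow>
    (b \<noteq> [] \<longrightarrow> 1 \<le> jj b 1 \<and> jj b 1 \<le> n + 1 \<and> 0 \<le> ii b 1 \<and> ii b 1 \<le> n - 1) \<and>
    (\<forall>s\<in>{2..length b}.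
      ((ii b s = 0 \<and> jj b s = 1) \<or>
       (1 \<le> ii b s \<and> ii b s \<le> n - 1 \<and> 1 \<le> jj b s \<and> jj b s \<le> n)) \<and>
      jj b s \<le> jj b (s - 1) \<and> ii b (s - 1) \<le> ii b s \<and>
      (jj b (s - 1) > ii b (s - 1) + 1 \<longrightarrow> jj b s < jj b (s - 1)) \<and>
      (jj b s > ii b s + 1 \<longrightarrow> ii b s > ii b (s - 1)))"

text \<open>
  \<open>differ_at b b' r\<close>: the tuples \<open>(j\<^sub>1, i\<^sub>1, ..., j\<^sub>m, i\<^sub>m)\<close> and \<open>(j'\<^sub>1, i'\<^sub>1, ..., j'\<^sub>m, i'\<^sub>m)\<close> of
  two blocks of the same affine length differ in exactly one entry, which is \<open>j\<^sub>r\<close> or \<open>i\<^sub>r\<close>.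
\<close>

definition differ_at :: "(nat \<times> nat) list \<Rightarrow> (nat \<times> nat) list \<Rightarrow> nat \<Rightarrow> bool" where
  "differ_at b b' r \<longleftrightarrow>
    r \<in> {1..length b} \<and>
    (\<forall>t\<in>{1..length b}. t \<noteq> r \<longrightarrow> jj b' t = jj b t \<and> ii b' t = ii b t) \<and>
    ((jj b' r \<noteq> jj b r \<and> ii b' r = ii b r) \<or> (jj b' r = jj b r \<and> ii b' r \<noteq> ii b r))"

end

theory Submission
  imports Defs
begin

text \<open>
  The left cosets of \<open>W(A\<^sub>n)\<close> are the integer vectors \<open>(c\<^sub>1, \<dots>, c\<^sub>n\<^sub>+\<^sub>1)\<close> in the orbit of \<open>0\<close>, on which
  \<open>\<sigma>\<^sub>k\<close> exchanges \<open>c\<^sub>k\<close> and \<open>c\<^sub>k\<^sub>+\<^sub>1\<close>, and \<open>a\<^sub>n\<^sub>+\<^sub>1\<close> replaces \<open>(c\<^sub>1, c\<^sub>n\<^sub>+\<^sub>1)\<close> by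
  \<open>(c\<^sub>n\<^sub>+\<^sub>1 + 1, c\<^sub>1 - 1)\<close>. Applying \<open>B(j, i)\<close> to a vector \<open>R\<close> inserts \<open>R\<^sub>n\<^sub>+\<^sub>1 + 1\<close> at a position
  \<open>p\<close> and \<open>R\<^sub>1 - 1\<close> at the position \<open>j\<close> into \<open>R\<^sub>2, \<dots>, R\<^sub>n\<close>. The inequalities that define an affine
  block say exactly that, at every stage, \<open>p\<close> is the first positive and \<open>j\<close> the last negative
  position. Hence a vector determines its block, and the effect of a generator on the block can be
  read off the vector: the length goes up, stays or goes down with the sign of
  \<open>c\<^sub>s - c\<^sub>s\<^sub>+\<^sub>1\<close> (of \<open>c\<^sub>n\<^sub>+\<^sub>1 + 1 - c\<^sub>1\<close> for \<open>a\<^sub>n\<^sub>+\<^sub>1\<close>), and either the first block changes, or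
  the generator passes to a generator acting on one of the following two tails.

  Back in the group, Matsumoto's argument applied to vectors instead of group elements shows that
  two words of minimal length leading from \<open>0\<close> to the same vector express the same element. So block
  words express the distinguished representatives, and a generator that fixes the vector can be moved
  to the right end of the word by Deodhar's lemma.
\<close>

section \<open>Vectors and blocks\<close>

definition vec_act :: "nat \<Rightarrow> nat \<Rightarrow> (nat \<Rightarrow> int) \<Rightarrow> nat \<Rightarrow> int" where
  "vec_act n s c x =
    (if s = n + 1
     then (if x = 1 then c (n + 1) + 1 else if x = n + 1 then c 1 - 1 else c x)
     else (if x = s then c (s + 1) else if x = s + 1 then c s else c x))"

text \<open>These are the affine simple roots evaluated at \<open>c\<close>. The generator
  \<open>s\<close> fixes \<open>c\<close> exactly when \<open>gap n s c = 0\<close>; at the zero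
  vector only the root of \<open>n + 1\<close> is nonzero, with value 1.\<close>

definition gap :: "nat \<Rightarrow> nat \<Rightarrow> (nat \<Rightarrow> int) \<Rightarrow> int" where
  "gap n s c = (if s = n + 1 then c (n + 1) - c 1 + 1 else c s - c (s + 1))"

text \<open>The position of the new positive entry once the negative one has moved to position \<open>j\<close>.\<close>

definition pos :: "nat \<Rightarrow> nat \<Rightarrow> nat" where
  "pos j i = (if i + 1 < j then i + 1 else i + 2)"

text \<open>The increasing bijection from the positions other than \<open>p\<close> and
  \<open>q\<close> onto \<open>{2..n}\<close>: it tells which of the entries
  \<open>R 2, ..., R n\<close> fills position \<open>x\<close>.\<close>

definition rest_index :: "nat \<Rightarrow> nat \<Rightarrow> nat \<Rightarrow> nat" where
  "rest_index p q x = (if p < x \<and> q < x then x - 1 else if p < x \<or> q < x then x else x + 1)"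

text \<open>Vectors are extended by \<open>0\<close> outside \<open>{1..n+1}\<close>, which makes equality of vectors equality of functions.\<close>

definition insert_step :: "nat \<Rightarrow> nat \<Rightarrow> nat \<Rightarrow> (nat \<Rightarrow> int) \<Rightarrow> nat \<Rightarrow> int" where
  "insert_step n p q R x =
    (if x < 1 \<or> n + 1 < x then 0
     else if x = p then R (n + 1) + 1
     else if x = q then R 1 - 1
     else R (rest_index p q x))"

fun block_vec :: "nat \<Rightarrow> (nat \<times> nat) list \<Rightarrow> nat \<Rightarrow> int" where
  "block_vec n [] = (\<lambda>_. 0)"
| "block_vec n ((j, i) # b) = insert_step n (pos j i) j (block_vec n b)"

definition first_last :: "nat \<Rightarrow> nat \<Rightarrow> nat \<Rightarrow> (nat \<Rightarrow> int) \<Rightarrow> bool" where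
  "first_last n p q c \<longleftrightarrow> c p > 0 \<and> c q < 0 \<and>
     (\<forall>x. 1 \<le> x \<and> x < p \<longrightarrow> c x \<le> 0) \<and> (\<forall>x. q < x \<and> x \<le> n + 1 \<longrightarrow> c x \<ge> 0)"

text \<open>The defining inequalities of an affine block recast as sign conditions on vectors;
  \<open>affine_block_iff_sign_block\<close> proves the equivalence. In this form the effect of a
  generator can be read off the vector.\<close>

fun sign_block :: "nat \<Rightarrow> (nat \<times> nat) list \<Rightarrow> bool" where
  "sign_block n [] \<longleftrightarrow> True"
| "sign_block n ((j, i) # b) \<longleftrightarrow> sign_block n b \<and> 1 \<le> j \<and> j \<le> n + 1 \<and> i + 1 \<le> n \<and>
     first_last n (pos j i) j (block_vec n ((j, i) # b))"

text \<open>The block on the right is the longer one: lowering \<open>j\<close> prolongs the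
  ascending part of \<open>h\<close>, raising \<open>i\<close> its descending part.\<close>

inductive raise :: "(nat \<times> nat) list \<Rightarrow> (nat \<times> nat) list \<Rightarrow> bool" where
  raise_j: "raise ((Suc j, i) # b) ((j, i) # b)"
| raise_i: "raise ((j, i) # b) ((j, Suc i) # b)"
| raise_Cons: "raise b b' \<Longrightarrow> raise (x # b) (x # b')"

fun block_len :: "nat \<Rightarrow> (nat \<times> nat) list \<Rightarrow> nat" where
  "block_len n [] = 0"
| "block_len n ((j, i) # b) = (n + 1 - j) + i + 1 + block_len n b"

section \<open>Positions and signs under an insertion\<close>

lemma pos_range: "1 \<le> j \<Longrightarrow> j \<le> n + 1 \<Longrightarrow> i + 1 \<le> n \<Longrightarrow> 1 \<le> pos j i \<and> pos j i \<le> n + 1 \<and> pos j i \<noteq> j"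
  by (auto simp: pos_def)

lemma rest_index_less:
  assumes "1 \<le> x" "x < y" "p \<noteq> q" "x \<noteq> p" "x \<noteq> q" "y \<noteq> p" "y \<noteq> q"
  shows "rest_index p q x < rest_index p q y"
proof -
  have p: "p < x \<or> x < p \<and> p < y \<or> y < p" and q: "q < x \<or> x < q \<and> q < y \<or> y < q"
    using assms by linarith+
  have pq: "p < q \<or> q < p" using assms by linarith
  show ?thesis
    using p q pq assms(1,2) unfolding rest_index_def
    by (elim disjE conjE; simp; arith)
qed

text \<open>No inserted position is \<open>k\<close> or \<open>k + 1\<close>, so these two remain
  neighbours after relabelling. The exchange therefore passes to the neighbours \<open>k'\<close>
  and \<open>k' + 1\<close> of \<open>R\<close> with the same difference.\<close>

lemma insert_step_act:
  assumes pq: "1 \<le> p" "p \<le> n + 1" "1 \<le> q" "q \<le> n + 1" "p \<noteq> q"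
    and k: "1 \<le> k" "k \<le> n" "k \<noteq> p" "k \<noteq> q" "k + 1 \<noteq> p" "k + 1 \<noteq> q"
  defines "k' \<equiv> rest_index p q k"
  shows "1 \<le> k'" "k' \<le> n" 
    "insert_step n p q (vec_act n k' R) = vec_act n k (insert_step n p q R)"
    "gap n k' R = gap n k (insert_step n p q R)"
proof -
  have k': "1 < k'" "k' < n" using assms by (auto simp: rest_index_def split: if_splits)
  then show "1 \<le> k'" "k' \<le> n" by auto
  have Suc: "rest_index p q (k + 1) = k' + 1"
    using pq k by (auto simp: rest_index_def k'_def)
  have iff: "rest_index p q x = k' \<longleftrightarrow> x = k" "rest_index p q x = k' + 1 \<longleftrightarrow> x = k + 1"
    if "1 \<le> x" "x \<noteq> p" "x \<noteq> q" for x
    using rest_index_less[of x k p q] rest_index_less[of k x p q]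
      rest_index_less[of x "k + 1" p q] rest_index_less[of "k + 1" x p q] Suc pq k that
    unfolding k'_def by (metis less_irrefl linorder_neqE_nat le_add2)+
  show "insert_step n p q (vec_act n k' R) = vec_act n k (insert_step n p q R)"
    using pq k k' by (intro ext) (auto simp: insert_step_def vec_act_def iff Suc[simplified] k'_def[symmetric] iff[simplified])
  show "gap n k' R = gap n k (insert_step n p q R)"
    using pq k k' Suc by (auto simp: insert_step_def gap_def k'_def[symmetric])
qed


text \<open>One claim for each way in which the exchanged positions meet the first positive and the
  last negative one; \<open>sign_block_moves\<close> splits into the same cases. A sign hypothesis
  on the neighbour appears only where \<open>first_last\<close> does not determine it.\<close>

lemma first_last_act:
  assumes "first_last n p q c" "1 \<le> p" "p \<le> n + 1" "1 \<le> q" "q \<le> n + 1" "p \<noteq> q" "1 \<le> k" "k \<le> n"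
  shows "k \<noteq> p \<Longrightarrow> k \<noteq> q \<Longrightarrow> k + 1 \<noteq> p \<Longrightarrow> k + 1 \<noteq> q \<Longrightarrow> first_last n p q (vec_act n k c)"
    and "k = p \<Longrightarrow> k + 1 = q \<Longrightarrow> first_last n q p (vec_act n k c)"
    and "k = q \<Longrightarrow> k + 1 = p \<Longrightarrow> first_last n q p (vec_act n k c)"
    and "k = p \<Longrightarrow> k + 1 \<noteq> q \<Longrightarrow> c (k + 1) \<le> 0 \<Longrightarrow> first_last n (p + 1) q (vec_act n k c)"
    and "k = p \<Longrightarrow> k + 1 \<noteq> q \<Longrightarrow> c (k + 1) > 0 \<Longrightarrow> first_last n p q (vec_act n k c)"
    and "k \<noteq> q \<Longrightarrow> k + 1 = p \<Longrightarrow> first_last n (p - 1) q (vec_act n k c)"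
    and "k + 1 = q \<Longrightarrow> k \<noteq> p \<Longrightarrow> c k \<ge> 0 \<Longrightarrow> first_last n p (q - 1) (vec_act n k c)"
    and "k + 1 = q \<Longrightarrow> k \<noteq> p \<Longrightarrow> c k < 0 \<Longrightarrow> first_last n p q (vec_act n k c)"
    and "k = q \<Longrightarrow> k + 1 \<noteq> p \<Longrightarrow> first_last n p (q + 1) (vec_act n k c)"
proof -
  have FL: "c p > 0" "c q < 0" "\<And>x. 1 \<le> x \<Longrightarrow> x < p \<Longrightarrow> c x \<le> 0" "\<And>x. q < x \<Longrightarrow> x \<le> n + 1 \<Longrightarrow> c x \<ge> 0"
    using assms(1) by (auto simp: first_last_def)
  show "k \<noteq> p \<Longrightarrow> k \<noteq> q \<Longrightarrow> k + 1 \<noteq> p \<Longrightarrow> k + 1 \<noteq> q \<Longrightarrow> first_last n p q (vec_act n k c)"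
    using FL assms(2-) unfolding first_last_def vec_act_def
    by (auto simp: less_Suc_eq)
  show "k = p \<Longrightarrow> k + 1 = q \<Longrightarrow> first_last n q p (vec_act n k c)"
    using FL assms(2-) unfolding first_last_def vec_act_def
    by (auto simp: less_Suc_eq)
  show "k = q \<Longrightarrow> k + 1 = p \<Longrightarrow> first_last n q p (vec_act n k c)"
    using FL assms(2-) unfolding first_last_def vec_act_def
    by (auto simp: less_Suc_eq)
  show "k = p \<Longrightarrow> k + 1 \<noteq> q \<Longrightarrow> c (k + 1) \<le> 0 \<Longrightarrow> first_last n (p + 1) q (vec_act n k c)"
    using FL assms(2-) unfolding first_last_def vec_act_def
    by (auto simp: less_Suc_eq)
  show "k = p \<Longrightarrow> k + 1 \<noteq> q \<Longrightarrow> c (k + 1) > 0 \<Longrightarrow> first_last n p q (vec_act n k c)"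
    using FL assms(2-) unfolding first_last_def vec_act_def
    by (auto simp: less_Suc_eq)
  show "k \<noteq> q \<Longrightarrow> k + 1 = p \<Longrightarrow> first_last n (p - 1) q (vec_act n k c)"
    using FL assms(2-) unfolding first_last_def vec_act_def
    by (auto simp: less_Suc_eq)
  show "k + 1 = q \<Longrightarrow> k \<noteq> p \<Longrightarrow> c k \<ge> 0 \<Longrightarrow> first_last n p (q - 1) (vec_act n k c)"
    using FL assms(2-) unfolding first_last_def vec_act_def
    by (auto simp: less_Suc_eq)
  show "k + 1 = q \<Longrightarrow> k \<noteq> p \<Longrightarrow> c k < 0 \<Longrightarrow> first_last n p q (vec_act n k c)"
    using FL assms(2-) unfolding first_last_def vec_act_def
    by (auto simp: less_Suc_eq)
  show "k = q \<Longrightarrow> k + 1 \<noteq> p \<Longrightarrow> first_last n p (q + 1) (vec_act n k c)"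
    using FL assms(2-) unfolding first_last_def vec_act_def
    by (auto simp: less_Suc_eq)
qed

section \<open>Exchanges and affine reflections across an insertion\<close>

lemma vec_act_vec_act: "1 \<le> n \<Longrightarrow> vec_act n s (vec_act n s c) = c"
  by (auto simp: vec_act_def)

lemma insert_step_swap:
  assumes "1 \<le> p" "p \<le> n"
  shows "insert_step n (p + 1) p R = vec_act n p (insert_step n p (p + 1) R)"
    and "insert_step n p (p + 1) R = vec_act n p (insert_step n (p + 1) p R)"
proof -
  show "insert_step n (p + 1) p R = vec_act n p (insert_step n p (p + 1) R)"
    using assms by (intro ext) (auto simp: insert_step_def vec_act_def rest_index_def)
  then show "insert_step n p (p + 1) R = vec_act n p (insert_step n (p + 1) p R)"
    using assms by (simp add: vec_act_vec_act)
qed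

lemma insert_step_Suc_left:
  assumes "1 \<le> p" "p \<le> n" "q \<noteq> p" "q \<noteq> p + 1"
  shows "insert_step n (p + 1) q R = vec_act n p (insert_step n p q R)"
    and "insert_step n p q R = vec_act n p (insert_step n (p + 1) q R)"
proof -
  have "q < p \<or> p + 1 < q" using assms by linarith
  then show "insert_step n (p + 1) q R = vec_act n p (insert_step n p q R)"
    using assms(1,2) by (intro ext) (auto simp: insert_step_def vec_act_def rest_index_def)
  then show "insert_step n p q R = vec_act n p (insert_step n (p + 1) q R)"
    using assms by (simp add: vec_act_vec_act)
qed

lemma insert_step_Suc_right:
  assumes "1 \<le> q" "q \<le> n" "p \<noteq> q" "p \<noteq> q + 1"
  shows "insert_step n p (q + 1) R = vec_act n q (insert_step n p q R)"
    and "insert_step n p q R = vec_act n q (insert_step n p (q + 1) R)"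
proof -
  have "p < q \<or> q + 1 < p" using assms by linarith
  then show "insert_step n p (q + 1) R = vec_act n q (insert_step n p q R)"
    using assms(1,2) by (intro ext) (auto simp: insert_step_def vec_act_def rest_index_def)
  then show "insert_step n p q R = vec_act n q (insert_step n p (q + 1) R)"
    using assms by (simp add: vec_act_vec_act)
qed

lemma rest_index_bounds:
  assumes "1 \<le> p" "p \<le> n + 1" "1 \<le> q" "q \<le> n + 1" "p \<noteq> q" "1 \<le> x" "x \<le> n + 1" "x \<noteq> p" "x \<noteq> q"
  shows "2 \<le> rest_index p q x" "rest_index p q x \<le> n"
  using assms by (auto simp: rest_index_def)

lemma rest_index_inj:
  assumes "1 \<le> x" "1 \<le> y" "p \<noteq> q" "x \<noteq> p" "x \<noteq> q" "y \<noteq> p" "y \<noteq> q"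
  shows "rest_index p q x = rest_index p q y \<longleftrightarrow> x = y"
  using assms rest_index_less[of x y p q] rest_index_less[of y x p q]
  by (metis less_irrefl linorder_neqE_nat)

lemma rest_index_surj:
  assumes "1 \<le> p" "p \<le> n + 1" "1 \<le> q" "q \<le> n + 1" "p \<noteq> q" "2 \<le> y" "y \<le> n"
  obtains x where "1 \<le> x" "x \<le> n + 1" "x \<noteq> p" "x \<noteq> q" "rest_index p q x = y" "x \<le> y + 1" "y - 1 \<le> x"
proof (cases "p < q")
  case True
  define x where "x = (if y \<le> p then y - 1 else if y < q then y else y + 1)"
  show ?thesis
    using assms True by (intro that[of x]) (auto simp: x_def rest_index_def)
next
  case False
  define x where "x = (if y \<le> q then y - 1 else if y < p then y else y + 1)"
  show ?thesis
    using assms False by (intro that[of x]) (auto simp: x_def rest_index_def)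
qed

text \<open>The entries \<open>R n\<close> and \<open>R (n + 1)\<close> land at \<open>n + 1\<close>
  and, raised by 1, at \<open>p\<close>. Exchanging them in \<open>R\<close> thus becomes the affine
  reflection in the positions \<open>p\<close> and \<open>n + 1\<close>, which for
  \<open>p = 1\<close> is the generator \<open>n + 1\<close>.\<close>

lemma insert_step_act_last:
  fixes R :: "nat \<Rightarrow> int"
  assumes "2 \<le> n" "1 \<le> p" "p \<le> n" "1 \<le> q" "q \<le> n" "p \<noteq> q"
  defines "f \<equiv> insert_step n p q R"
  shows "insert_step n p q (vec_act n n R) = f(p := f (n + 1) + 1, n + 1 := f p - 1)"
proof -
  have N: "rest_index p q (n + 1) = n" using assms by (auto simp: rest_index_def)
  have "rest_index p q x = n \<longleftrightarrow> x = n + 1" "rest_index p q x \<noteq> n + 1" if "1 \<le> x" "x \<le> n + 1" "x \<noteq> p" "x \<noteq> q" for x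
    using rest_index_inj[of x "n + 1" p q] N rest_index_bounds[of p n q x] that assms by auto
  then show ?thesis
    using assms(1-6) N by (intro ext) (auto simp: insert_step_def vec_act_def f_def N[simplified])
qed

text \<open>Mirror image: \<open>R 2\<close> and \<open>R 1\<close> land at position 1 and, lowered
  by 1, at \<open>q\<close>. For \<open>q = n + 1\<close> the resulting reflection is the generator
  \<open>n + 1\<close>.\<close>

lemma insert_step_act_first:
  fixes R :: "nat \<Rightarrow> int"
  assumes "2 \<le> n" "2 \<le> p" "p \<le> n + 1" "2 \<le> q" "q \<le> n + 1" "p \<noteq> q"
  defines "f \<equiv> insert_step n p q R"
  shows "insert_step n p q (vec_act n 1 R) = f(q := f 1 - 1, 1 := f q + 1)"
proof -
  have N: "rest_index p q 1 = 2" using assms by (auto simp: rest_index_def)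
  have "rest_index p q x = 2 \<longleftrightarrow> x = 1" "rest_index p q x \<noteq> 1" "0 < rest_index p q x" if "1 \<le> x" "x \<le> n + 1" "x \<noteq> p" "x \<noteq> q" for x
    using rest_index_inj[of x "1" p q] N rest_index_bounds[of p n q x] that assms by auto
  then show ?thesis
    using assms(1-6) N by (intro ext) (auto simp: insert_step_def vec_act_def f_def N[simplified] numeral_2_eq_2)
qed

text \<open>The entries of \<open>R\<close> at \<open>n + 1\<close> and \<open>t\<close> arrive at
  \<open>p\<close> and \<open>p + 1\<close>, the former raised by 1. This cancels the shift in the
  reflection of \<open>R\<close>, and a plain exchange remains.\<close>

lemma insert_step_reflect_last:
  assumes "2 \<le> n" "1 \<le> p" "p \<le> n" "1 \<le> q" "q \<le> n + 1" "p \<noteq> q" "q \<noteq> p + 1"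
  defines "t \<equiv> rest_index p q (p + 1)"
  shows "insert_step n p q (R(t := R (n + 1) + 1, n + 1 := R t - 1)) = vec_act n p (insert_step n p q R)"
proof -
  have t: "2 \<le> t" "t \<le> n"
    using rest_index_bounds[of p n q "p + 1"] assms by auto
  have "rest_index p q x = t \<longleftrightarrow> x = p + 1" "rest_index p q x \<noteq> n + 1"
    if "1 \<le> x" "x \<le> n + 1" "x \<noteq> p" "x \<noteq> q" for x
    using rest_index_inj[of x "p + 1" p q] rest_index_bounds[of p n q x] rest_index_bounds[of p n q "p + 1"]
      that assms by auto
  then show ?thesis
    using assms(1-7) t by (intro ext) (auto simp: insert_step_def vec_act_def t_def[symmetric, simplified])
qed

lemma insert_step_reflect_first:
  assumes "2 \<le> n" "1 \<le> p" "p \<le> n + 1" "1 \<le> q" "q \<le> n" "p \<noteq> q" "p \<noteq> q + 1"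
  defines "t \<equiv> rest_index p (q + 1) q"
  shows "insert_step n p (q + 1) (R(t := R 1 - 1, 1 := R t + 1)) = vec_act n q (insert_step n p (q + 1) R)"
proof -
  have t: "2 \<le> t" "t \<le> n"
    using rest_index_bounds[of p n "q + 1" q] assms by auto
  have "rest_index p (q + 1) x = t \<longleftrightarrow> x = q" "rest_index p (q + 1) x \<noteq> 1"
    if "1 \<le> x" "x \<le> n + 1" "x \<noteq> p" "x \<noteq> q + 1" for x
    using rest_index_inj[of x q p "q + 1"] rest_index_bounds[of p n "q + 1" x]
      that assms by auto
  then show ?thesis
    using assms(1-7) t by (intro ext) (auto simp: insert_step_def vec_act_def t_def[symmetric, simplified])
qed

text \<open>The induction claim. The new vector \<open>c\<close> and the gap \<open>g\<close> are
  separate parameters because on passing to a tail the vector changes while the gap is carried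
  along. Nothing is claimed for \<open>g = 0\<close>.\<close>

definition block_moves :: "nat \<Rightarrow> (nat \<times> nat) list \<Rightarrow> (nat \<Rightarrow> int) \<Rightarrow> int \<Rightarrow> bool" where
  "block_moves n b c g \<longleftrightarrow>
    (0 < g \<longrightarrow> (\<exists>b'. sign_block n b' \<and> block_vec n b' = c \<and> raise b b')) \<and>
    (g < 0 \<longrightarrow> (\<exists>b'. sign_block n b' \<and> block_vec n b' = c \<and> raise b' b))"

lemma block_moves_Cons:
  assumes "block_moves n t R g" "1 \<le> j" "j \<le> n + 1" "i + 1 \<le> n"
    and "first_last n (pos j i) j (insert_step n (pos j i) j R)"
  shows "block_moves n ((j, i) # t) (insert_step n (pos j i) j R) g"
proof -
  have "sign_block n ((j, i) # b') \<and> block_vec n ((j, i) # b') = insert_step n (pos j i) j R"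
    if "sign_block n b'" "block_vec n b' = R" for b'
    using that assms(2-) by simp
  then show ?thesis
    using assms(1) unfolding block_moves_def by (blast intro: raise_Cons)
qed

lemma block_moves_head:
  assumes "sign_block n t" "1 \<le> j'" "j' \<le> n + 1" "i' + 1 \<le> n"
    and "first_last n (pos j' i') j' c" "c = insert_step n (pos j' i') j' (block_vec n t)"
    and "0 < g \<Longrightarrow> raise ((j, i) # t) ((j', i') # t)"
    and "g < 0 \<Longrightarrow> raise ((j', i') # t) ((j, i) # t)"
  shows "block_moves n ((j, i) # t) c g"
proof -
  have "sign_block n ((j', i') # t) \<and> block_vec n ((j', i') # t) = c"
    using assms(1-6) by simp
  then show ?thesis
    using assms(7,8) unfolding block_moves_def by blast
qed

lemma raise_head:
  "(j = j' + 1 \<and> i' = i) \<or> (j' = j \<and> i' = i + 1) \<Longrightarrow> raise ((j, i) # t) ((j', i') # t)"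
  using raise_j raise_i by auto

section \<open>Reading the first pair of the tail off the vector\<close>

lemma insert_step_simps:
  assumes "1 \<le> p" "p \<le> n + 1" "1 \<le> q" "q \<le> n + 1" "p \<noteq> q"
  shows "insert_step n p q R p = R (n + 1) + 1" "insert_step n p q R q = R 1 - 1"
    "1 \<le> x \<Longrightarrow> x \<le> n + 1 \<Longrightarrow> x \<noteq> p \<Longrightarrow> x \<noteq> q \<Longrightarrow> insert_step n p q R x = R (rest_index p q x)"
  using assms by (auto simp: insert_step_def)

lemma block_vec_outside: "x < 1 \<or> n + 1 < x \<Longrightarrow> block_vec n b x = 0"
  by (induction b) (auto simp: insert_step_def)

text \<open>The inserted entries \<open>R (n + 1) + 1\<close> and \<open>R 1 - 1\<close> are
  strictly positive and negative; for integers this gives weak inequalities for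
  \<open>R\<close>.\<close>

lemma sign_block_tail_ends:
  assumes "sign_block n ((j, i) # b)"
  shows "block_vec n b 1 \<le> 0" "0 \<le> block_vec n b (n + 1)"
    and "block_vec n ((j, i) # b) (pos j i) > 0" "block_vec n ((j, i) # b) j < 0"
  using assms pos_range[of j n i] by (auto simp: first_last_def insert_step_def)

text \<open>The relabelling is increasing and the entries before \<open>p\<close> are nonpositive,
  so the positive entry right after \<open>p\<close> is the first positive one of the tail. Index 1
  of the tail is outside the relabelling and is handled by \<open>R 1 \<le> 0\<close>.\<close>

lemma tail_first:
  assumes sb: "sign_block n ((j, i) # b)" and p: "p = pos j i" "p \<le> n" "j \<noteq> p + 1"
    and c: "block_vec n ((j, i) # b) (p + 1) > 0"
  obtains j2 i2 t where "b = (j2, i2) # t" "pos j2 i2 = rest_index p j (p + 1)" "2 \<le> pos j2 i2" "pos j2 i2 \<le> n" "1 \<le> j2" "j2 \<le> n"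
proof -
  define R where "R = block_vec n b"
  define c where "c = block_vec n ((j, i) # b)"
  have c_eq: "c = insert_step n p j R" by (simp add: c_def R_def p)
  have rng: "1 \<le> p" "p \<le> n + 1" "1 \<le> j" "j \<le> n + 1" "p \<noteq> j"
    using sb pos_range[of j n i] p by auto
  define u where "u = rest_index p j (p + 1)"
  have u: "2 \<le> u" "u \<le> n" using rest_index_bounds[of p n j "p + 1"] rng p by (auto simp: u_def)
  have Ru: "R u > 0"
    using insert_step_simps(3)[of p n j "p + 1" R] rng p \<open>block_vec n ((j, i) # b) (p + 1) > 0\<close>
    by (simp add: u_def R_def)
  then obtain j2 i2 t where b: "b = (j2, i2) # t"
    by (cases b) (auto simp: R_def)
  have sb2: "sign_block n ((j2, i2) # t)" using sb b by simp
  have fl: "first_last n (pos j2 i2) j2 R" using sb2 by (simp add: R_def b)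
  have ends: "R 1 \<le> 0" "0 \<le> R (n + 1)" using sign_block_tail_ends[OF sb] by (auto simp: R_def)
  have rng2: "1 \<le> pos j2 i2" "pos j2 i2 \<le> n + 1" "1 \<le> j2" "j2 \<le> n + 1"
    using sb2 pos_range[of j2 n i2] by auto
  have "R u \<le> 0" if "u < pos j2 i2" using that fl u unfolding first_last_def by simp
  then have "\<not> u < pos j2 i2" using Ru by force
  moreover have "\<not> pos j2 i2 < u"
  proof
    assume less: "pos j2 i2 < u"
    have R2: "R (pos j2 i2) > 0" using fl by (simp add: first_last_def)
    then have "pos j2 i2 \<noteq> 1" using ends by force
    then have "2 \<le> pos j2 i2" "pos j2 i2 \<le> n" using rng2 less u by auto
    then obtain x where x: "1 \<le> x" "x \<le> n + 1" "x \<noteq> p" "x \<noteq> j" "rest_index p j x = pos j2 i2"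
      using rest_index_surj[OF rng, of "pos j2 i2"] by metis
    have "\<not> p + 1 \<le> x"
      using rest_index_less[of "p + 1" x p j] less x p rng unfolding u_def
      by (metis le_add2 le_neq_implies_less less_irrefl less_trans n_not_Suc_n Suc_eq_plus1)
    then have "x < p" using x by auto
    then have "c x \<le> 0" using sb x p by (auto simp: c_def first_last_def)
    then show False using R2 insert_step_simps(3)[OF rng, of x R] x by (simp add: c_eq)
  qed
  ultimately have "pos j2 i2 = u" by simp
  moreover have "j2 \<noteq> n + 1" using fl ends by (auto simp: first_last_def)
  ultimately show ?thesis using that[OF b] u rng2 by (auto simp: u_def)
qed

text \<open>Mirror image of \<open>tail_first\<close>, with \<open>0 \<le> R (n + 1)\<close>
  handling the index \<open>n + 1\<close>.\<close>

lemma tail_last: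
  assumes sb: "sign_block n ((j, i) # b)" and q: "j = q + 1" "1 \<le> q" "pos j i \<noteq> q"
    and c: "block_vec n ((j, i) # b) q < 0"
  obtains j2 i2 t where "b = (j2, i2) # t" "j2 = rest_index (pos j i) j q" "2 \<le> j2" "j2 \<le> n" "2 \<le> pos j2 i2" "pos j2 i2 \<le> n + 1"
proof -
  define p where "p = pos j i"
  define R where "R = block_vec n b"
  define c where "c = block_vec n ((j, i) # b)"
  have c_eq: "c = insert_step n p j R" by (simp add: c_def R_def p_def)
  have rng: "1 \<le> p" "p \<le> n + 1" "1 \<le> j" "j \<le> n + 1" "p \<noteq> j"
    using sb pos_range[of j n i] by (auto simp: p_def)
  define u where "u = rest_index p j q"
  have u: "2 \<le> u" "u \<le> n" using rest_index_bounds[of p n j q] rng q by (auto simp: u_def p_def)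
  have Ru: "R u < 0"
    using insert_step_simps(3)[of p n j q R] rng q \<open>block_vec n ((j, i) # b) q < 0\<close>
    by (simp add: u_def R_def p_def)
  then obtain j2 i2 t where b: "b = (j2, i2) # t"
    by (cases b) (auto simp: R_def)
  have sb2: "sign_block n ((j2, i2) # t)" using sb b by simp
  have fl: "first_last n (pos j2 i2) j2 R" using sb2 by (simp add: R_def b)
  have ends: "R 1 \<le> 0" "0 \<le> R (n + 1)" using sign_block_tail_ends[OF sb] by (auto simp: R_def)
  have rng2: "1 \<le> pos j2 i2" "pos j2 i2 \<le> n + 1" "1 \<le> j2" "j2 \<le> n + 1"
    using sb2 pos_range[of j2 n i2] by auto
  have "0 \<le> R u" if "j2 < u" using that fl u unfolding first_last_def by simp
  then have "\<not> j2 < u" using Ru by force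
  moreover have "\<not> u < j2"
  proof
    assume less: "u < j2"
    have R2: "R j2 < 0" using fl by (simp add: first_last_def)
    then have "j2 \<noteq> n + 1" using ends by force
    then have "2 \<le> j2" "j2 \<le> n" using rng2 less u by auto
    then obtain x where x: "1 \<le> x" "x \<le> n + 1" "x \<noteq> p" "x \<noteq> j" "rest_index p j x = j2"
      using rest_index_surj[OF rng, of j2] by metis
    have "\<not> x \<le> q"
      using rest_index_less[of x q p j] less x q rng unfolding u_def p_def
      by (metis le_neq_implies_less less_irrefl less_trans n_not_Suc_n Suc_eq_plus1)
    then have "j < x" using x q by auto
    then have "c x \<ge> 0" using sb x by (auto simp: c_def first_last_def)
    then show False using R2 insert_step_simps(3)[OF rng, of x R] x by (simp add: c_eq)
  qed
  ultimately have "j2 = u" by simp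
  moreover have "pos j2 i2 \<noteq> 1" using fl ends by (auto simp: first_last_def)
  ultimately show ?thesis using that[OF b] u rng2 by (auto simp: u_def p_def)
qed

text \<open>Induction on the length, since the generator may have to pass through two pairs before
  it is again a generator.\<close>

lemma sign_block_moves:
  assumes "2 \<le> n" "sign_block n b" "1 \<le> k" "k \<le> n"
  shows "block_moves n b (vec_act n k (block_vec n b)) (gap n k (block_vec n b))"
  using assms(2-)
proof (induction b arbitrary: k rule: length_induct)
  case (1 b)
  note IH = "1.IH"[rule_format]
  show ?case
  proof (cases b)
    case Nil
    then show ?thesis using 1 by (simp add: block_moves_def gap_def)
  next
    case (Cons ji t)
    obtain j i where ji: "ji = (j, i)" by fastforce
    define p where "p = pos j i"
    define R where "R = block_vec n t"
    define c where "c = block_vec n b"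
    note b = Cons[unfolded ji]
    have sb: "sign_block n ((j, i) # t)" using 1 b by simp
    have c_eq: "c = insert_step n p j R" by (simp add: c_def b R_def p_def)
    have sbt: "sign_block n t" and j: "1 \<le> j" "j \<le> n + 1" "i + 1 \<le> n" and fl: "first_last n p j c"
      using sb by (auto simp: c_def b p_def)
    have p: "1 \<le> p" "p \<le> n + 1" "p \<noteq> j"
      using j pos_range[of j n i] by (auto simp: p_def)
    have sgn: "c p > 0" "c j < 0" "\<And>x. 1 \<le> x \<Longrightarrow> x < p \<Longrightarrow> c x \<le> 0" "\<And>x. j < x \<Longrightarrow> x \<le> n + 1 \<Longrightarrow> 0 \<le> c x"
      using fl by (auto simp: first_last_def)
    have k: "1 \<le> k" "k \<le> n" using 1 by auto
    have gap: "gap n k c = c k - c (k + 1)" using k by (simp add: gap_def)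
    note fl_act = first_last_act[OF fl p(1,2) j(1,2) p(3) k]
    consider (other) "k \<noteq> p" "k \<noteq> j" "k + 1 \<noteq> p" "k + 1 \<noteq> j"
      | (pq) "k = p" "k + 1 = j" | (qp) "k = j" "k + 1 = p"
      | (p) "k = p" "k + 1 \<noteq> j" "c (k + 1) \<le> 0"
      | (p_reflect) "k = p" "k + 1 \<noteq> j" "c (k + 1) > 0"
      | (Suc_p) "k \<noteq> j" "k + 1 = p"
      | (Suc_q) "k + 1 = j" "k \<noteq> p" "c k \<ge> 0"
      | (Suc_q_reflect) "k + 1 = j" "k \<noteq> p" "c k < 0"
      | (q) "k = j" "k + 1 \<noteq> p"
      by linarith
    then have "block_moves n ((j, i) # t) (vec_act n k c) (gap n k c)"
    proof cases
      case other
      note act = insert_step_act[OF p(1,2) j(1,2) p(3) k other]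
      have "block_moves n t (vec_act n (rest_index p j k) R) (gap n k c)"
        using IH[of t "rest_index p j k"] act(1,2,4) sbt b by (simp add: R_def c_eq)
      then have "block_moves n ((j, i) # t) (insert_step n (pos j i) j (vec_act n (rest_index p j k) R)) (gap n k c)"
        by (rule block_moves_Cons) (use j fl_act(1) other act(3) in \<open>simp_all add: p_def c_eq\<close>)
      then show ?thesis using act(3) by (simp add: p_def c_eq)
    next
      case pq
      \<comment> \<open>This order of neighbours forces \<open>p = i + 1\<close> and
        \<open>j = i + 2\<close>. After the exchange \<open>pos\<close> takes its other branch, so
        \<open>j\<close> drops by one and \<open>i\<close> is kept.\<close>
      have i: "pos p i = j" using pq by (auto simp: p_def pos_def split: if_splits)
      show ?thesis
      proof (rule block_moves_head[OF sbt])
        show "1 \<le> p" "p \<le> n + 1" "i + 1 \<le> n" using p j by auto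
        show "first_last n (pos p i) p (vec_act n k c)" using fl_act(2) pq i by simp
        show "vec_act n k c = insert_step n (pos p i) p (block_vec n t)"
          using insert_step_swap(1)[of p n R] pq k i by (simp add: c_eq R_def)
        show "raise ((j, i) # t) ((p, i) # t)" by (rule raise_head) (use pq in simp)
        show "raise ((p, i) # t) ((j, i) # t)" if "gap n k c < 0" using that gap sgn pq by simp
      qed
    next
      case qp
      have i: "pos p i = j" using qp by (auto simp: p_def pos_def split: if_splits)
      show ?thesis
      proof (rule block_moves_head[OF sbt])
        show "1 \<le> p" "p \<le> n + 1" "i + 1 \<le> n" using p j by auto
        show "first_last n (pos p i) p (vec_act n k c)" using fl_act(3) qp i by simp
        show "vec_act n k c = insert_step n (pos p i) p (block_vec n t)"
          using insert_step_swap(2)[of j n R] qp k i by (simp add: c_eq R_def)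
        show "raise ((p, i) # t) ((j, i) # t)" by (rule raise_head) (use qp in simp)
        show "raise ((j, i) # t) ((p, i) # t)" if "0 < gap n k c"
          using that gap sgn(1,2) qp by simp
      qed
    next
      case p
      have i: "pos j (i + 1) = p + 1" "i + 1 + 1 \<le> n"
        using p \<open>p \<noteq> j\<close> j k by (auto simp: p_def pos_def split: if_splits)
      show ?thesis
      proof (rule block_moves_head[OF sbt])
        show "1 \<le> j" "j \<le> n + 1" "i + 1 + 1 \<le> n" using i j by auto
        show "first_last n (pos j (i + 1)) j (vec_act n k c)" using fl_act(4) p i by simp
        show "vec_act n k c = insert_step n (pos j (i + 1)) j (block_vec n t)"
          using insert_step_Suc_left(1)[of p n j R] p \<open>p \<noteq> j\<close> k i by (simp add: c_eq R_def)
        show "raise ((j, i) # t) ((j, i + 1) # t)" by (rule raise_head) simp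
        show "raise ((j, i + 1) # t) ((j, i) # t)" if "gap n k c < 0" using that gap sgn(1) p by simp
      qed
    next
      case Suc_p
      \<comment> \<open>The second equation says that \<open>i\<close> is positive, so that the
        truncated subtraction is exact.\<close>
      have i: "pos j (i - 1) = k" "i = i - 1 + 1"
        using Suc_p p j k by (auto simp: p_def pos_def split: if_splits)
      show ?thesis
      proof (rule block_moves_head[OF sbt])
        show "1 \<le> j" "j \<le> n + 1" "i - 1 + 1 \<le> n" using i j by auto
        show "first_last n (pos j (i - 1)) j (vec_act n k c)" using fl_act(6) Suc_p i by auto
        show "vec_act n k c = insert_step n (pos j (i - 1)) j (block_vec n t)"
          using insert_step_Suc_left(2)[of k n j R] Suc_p \<open>p \<noteq> j\<close> k i by (simp add: c_eq R_def)
        show "raise ((j, i - 1) # t) ((j, i) # t)" by (rule raise_head) (use i in simp)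
        show "raise ((j, i) # t) ((j, i - 1) # t)" if "0 < gap n k c"
          using that gap sgn(1) sgn(3)[of k] Suc_p k by simp
      qed
    next
      case q
      have i: "pos (j + 1) i = p"
        using q p j k by (auto simp: p_def pos_def split: if_splits)
      show ?thesis
      proof (rule block_moves_head[OF sbt])
        show "1 \<le> j + 1" "j + 1 \<le> n + 1" "i + 1 \<le> n" using q k j by auto
        show "first_last n (pos (j + 1) i) (j + 1) (vec_act n k c)" using fl_act(9) q i by auto
        show "vec_act n k c = insert_step n (pos (j + 1) i) (j + 1) (block_vec n t)"
          using insert_step_Suc_right(1)[of j n p R] q \<open>p \<noteq> j\<close> k i by (simp add: c_eq R_def)
        show "raise ((j + 1, i) # t) ((j, i) # t)" by (rule raise_head) simp
        show "raise ((j, i) # t) ((j + 1, i) # t)" if "0 < gap n k c"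
          using that gap sgn(2) sgn(4)[of "k + 1"] q k by simp
      qed
    next
      case Suc_q
      have i: "pos k i = p"
        using Suc_q p j k by (auto simp: p_def pos_def split: if_splits)
      show ?thesis
      proof (rule block_moves_head[OF sbt])
        show "1 \<le> k" "k \<le> n + 1" "i + 1 \<le> n" using k j by auto
        show "first_last n (pos k i) k (vec_act n k c)" using fl_act(7) Suc_q i by auto
        show "vec_act n k c = insert_step n (pos k i) k (block_vec n t)"
          using insert_step_Suc_right(2)[of k n p R] Suc_q \<open>p \<noteq> j\<close> k i by (simp add: c_eq R_def)
        show "raise ((j, i) # t) ((k, i) # t)" by (rule raise_head) (use Suc_q in simp)
        show "raise ((k, i) # t) ((j, i) # t)" if "gap n k c < 0"
          using that gap sgn(2) Suc_q k by simp
      qed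
    next
      case p_reflect
      txt \<open>Exchanging two positive entries changes the tail by an affine reflection, not a generator; one block
        further down it has become the generator \<open>n\<close>. Dually, two negative entries lead to the generator \<open>1\<close>.\<close>
      have pn: "p \<le> n" using p_reflect k by simp
      obtain j2 i2 t2 where t: "t = (j2, i2) # t2" and u: "pos j2 i2 = rest_index p j (p + 1)"
        "2 \<le> pos j2 i2" "pos j2 i2 \<le> n" "1 \<le> j2" "j2 \<le> n"
        using tail_first[OF sb p_def pn] p_reflect b by (metis c_def)
      define p2 where "p2 = pos j2 i2"
      define T where "T = block_vec n t2"
      have R: "R = insert_step n p2 j2 T" by (simp add: R_def t T_def p2_def)
      have sb2: "sign_block n t2" "i2 + 1 \<le> n" "first_last n p2 j2 R" using sbt by (auto simp: t R_def p2_def)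
      have "p2 \<noteq> j2" using pos_range[of j2 n i2] u sb2 by (auto simp: p2_def)
      note n = \<open>2 \<le> n\<close>
      have N: "rest_index p2 j2 (n + 1) = n" using u by (auto simp: rest_index_def p2_def)
      have Ru: "R p2 = c (p + 1)"
        using insert_step_simps(3)[OF p(1,2) j(1,2) p(3), of "p + 1" R] u pn p_reflect by (simp add: c_eq p2_def)
      have RN: "R (n + 1) = c p - 1"
        using insert_step_simps(1)[OF p(1,2) j(1,2) p(3), of R] by (simp add: c_eq)
      have R': "insert_step n p2 j2 (vec_act n n T) = R(p2 := R (n + 1) + 1, n + 1 := R p2 - 1)"
        unfolding R by (rule insert_step_act_last) (use n u \<open>p2 \<noteq> j2\<close> in \<open>auto simp: p2_def\<close>)
      have TN: "T (n + 1) + 1 = R p2" using insert_step_simps(1)[of p2 n j2 T] u \<open>p2 \<noteq> j2\<close> by (auto simp: R p2_def)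
      have Tn: "T n = R (n + 1)" using insert_step_simps(3)[of p2 n j2 "n + 1" T] u \<open>p2 \<noteq> j2\<close> N by (auto simp: R p2_def)
      \<comment> \<open>Both exchanged entries carry the same shift: \<open>c p = T n + 1\<close>
        and \<open>c (p + 1) = T (n + 1) + 1\<close>.\<close>
      have "gap n n T = gap n k c"
        using n TN Tn Ru RN p_reflect unfolding gap by (simp add: gap_def)
      then have "block_moves n t2 (vec_act n n T) (gap n k c)"
        using IH[of t2 n] sb2 b t n by (simp add: T_def)
      then have "block_moves n ((j2, i2) # t2) (insert_step n (pos j2 i2) j2 (vec_act n n T)) (gap n k c)"
      proof (rule block_moves_Cons)
        show "1 \<le> j2" "j2 \<le> n + 1" "i2 + 1 \<le> n" using u sb2 by auto
        \<comment> \<open>Only the values at \<open>p2\<close> and \<open>n + 1\<close> change. They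
          become \<open>c p > 0\<close> and \<open>c (p + 1) - 1 \<ge> 0\<close>, so both extreme
          positions stay.\<close>
        show "first_last n (pos j2 i2) j2 (insert_step n (pos j2 i2) j2 (vec_act n n T))"
          using sb2(3) u \<open>p2 \<noteq> j2\<close> Ru RN sgn(1) p_reflect(1,3) unfolding p2_def[symmetric] R' first_last_def
          by auto
      qed
      then have "block_moves n t (insert_step n p2 j2 (vec_act n n T)) (gap n k c)" by (simp add: t p2_def)
      then have *: "block_moves n ((j, i) # t) (insert_step n (pos j i) j (insert_step n p2 j2 (vec_act n n T))) (gap n k c)"
        if "first_last n (pos j i) j (insert_step n (pos j i) j (insert_step n p2 j2 (vec_act n n T)))"
        by (rule block_moves_Cons) (use j that in auto)
      \<comment> \<open>The inner insertion makes the generator \<open>n\<close> an affine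
        reflection of \<open>R\<close>, and the outer one makes this the exchange of
        \<open>p\<close> and \<open>p + 1\<close>.\<close>
      have "insert_step n (pos j i) j (insert_step n p2 j2 (vec_act n n T)) = vec_act n k c"
        using insert_step_reflect_last[of n p j R] n p pn j p_reflect
        unfolding R' c_eq p_def[symmetric] u(1)[symmetric] p2_def[symmetric] by simp
      then show ?thesis using * fl_act(5) p_reflect by (simp add: p_def)
    next
      case Suc_q_reflect
      obtain j2 i2 t2 where t: "t = (j2, i2) # t2" and u: "j2 = rest_index p j k"
        "2 \<le> j2" "j2 \<le> n" "2 \<le> pos j2 i2" "pos j2 i2 \<le> n + 1"
        using tail_last[OF sb _ k(1)] Suc_q_reflect b unfolding p_def c_def by metis
      define p2 where "p2 = pos j2 i2"
      define T where "T = block_vec n t2"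
      have R: "R = insert_step n p2 j2 T" by (simp add: R_def t T_def p2_def)
      have sb2: "sign_block n t2" "i2 + 1 \<le> n" "first_last n p2 j2 R" using sbt by (auto simp: t R_def p2_def)
      have "p2 \<noteq> j2" using pos_range[of j2 n i2] u sb2 by (auto simp: p2_def)
      note n = \<open>2 \<le> n\<close>
      have N: "rest_index p2 j2 1 = 2" using u by (auto simp: rest_index_def p2_def)
      have Ru: "R j2 = c k"
        using insert_step_simps(3)[OF p(1,2) j(1,2) p(3), of k R] u k Suc_q_reflect by (simp add: c_eq p2_def)
      have RN: "R 1 = c j + 1"
        using insert_step_simps(2)[OF p(1,2) j(1,2) p(3), of R] by (simp add: c_eq)
      have R': "insert_step n p2 j2 (vec_act n 1 T) = R(j2 := R 1 - 1, 1 := R j2 + 1)"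
        unfolding R by (rule insert_step_act_first) (use n u \<open>p2 \<noteq> j2\<close> in \<open>auto simp: p2_def\<close>)
      have TN: "T 1 - 1 = R j2" using insert_step_simps(2)[of p2 n j2 T] u \<open>p2 \<noteq> j2\<close> by (auto simp: R p2_def)
      have Tn: "T 2 = R 1" using insert_step_simps(3)[of p2 n j2 "1" T] u \<open>p2 \<noteq> j2\<close> N by (auto simp: R p2_def)
      \<comment> \<open>Here \<open>c k = T 1 - 1\<close> and \<open>c j = T 2 - 1\<close>, again
        with equal shifts.\<close>
      have "gap n 1 T = gap n k c"
        using n TN Tn Ru RN Suc_q_reflect unfolding gap by (simp add: gap_def numeral_2_eq_2)
      then have "block_moves n t2 (vec_act n 1 T) (gap n k c)"
        using IH[of t2 1] sb2 b t n by (simp add: T_def)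
      then have "block_moves n ((j2, i2) # t2) (insert_step n (pos j2 i2) j2 (vec_act n 1 T)) (gap n k c)"
      proof (rule block_moves_Cons)
        show "1 \<le> j2" "j2 \<le> n + 1" "i2 + 1 \<le> n" using u sb2 by auto
        show "first_last n (pos j2 i2) j2 (insert_step n (pos j2 i2) j2 (vec_act n 1 T))"
          using sb2(3) u \<open>p2 \<noteq> j2\<close> Ru RN sgn(2) Suc_q_reflect(1,3) unfolding p2_def[symmetric] R' first_last_def
          by auto
      qed
      then have "block_moves n t (insert_step n p2 j2 (vec_act n 1 T)) (gap n k c)" by (simp add: t p2_def)
      then have *: "block_moves n ((j, i) # t) (insert_step n (pos j i) j (insert_step n p2 j2 (vec_act n 1 T))) (gap n k c)"
        if "first_last n (pos j i) j (insert_step n (pos j i) j (insert_step n p2 j2 (vec_act n 1 T)))"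
        by (rule block_moves_Cons) (use j that in auto)
      have "insert_step n (pos j i) j (insert_step n p2 j2 (vec_act n 1 T)) = vec_act n k c"
        using insert_step_reflect_first[of n p k R] n p k Suc_q_reflect
        unfolding R' c_eq p_def[symmetric] by (simp add: u(1))
      then show ?thesis using * fl_act(8) Suc_q_reflect by (simp add: p_def)
    qed
    then show ?thesis by (simp add: b c_def)
  qed
qed

section \<open>The generators acting on blocks\<close>

lemma first_last_unique:
  assumes "first_last n p q c" "first_last n p' q' c" "1 \<le> p" "1 \<le> p'" "q \<le> n + 1" "q' \<le> n + 1"
  shows "p = p'" "q = q'"
proof -
  have "\<not> p < p'" "\<not> p' < p" "\<not> q < q'" "\<not> q' < q"
    using assms by (auto simp: first_last_def)
  then show "p = p'" "q = q'" by auto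
qed

lemma insert_step_inject:
  assumes "1 \<le> p" "p \<le> n + 1" "1 \<le> q" "q \<le> n + 1" "p \<noteq> q"
    and eq: "insert_step n p q R = insert_step n p q R'"
    and out: "\<And>x. x < 1 \<or> n + 1 < x \<Longrightarrow> R x = R' x"
  shows "R = R'"
proof
  fix y
  consider "y < 1 \<or> n + 1 < y" | "y = 1" | "y = n + 1" | "2 \<le> y" "y \<le> n" by linarith
  then show "R y = R' y"
  proof cases
    case 4
    then obtain x where x: "1 \<le> x" "x \<le> n + 1" "x \<noteq> p" "x \<noteq> q" "rest_index p q x = y"
      using rest_index_surj[OF assms(1-5), of y] by metis
    then show ?thesis
      using insert_step_simps(3)[OF assms(1-5) x(1-4), of R] insert_step_simps(3)[OF assms(1-5) x(1-4), of R'] eq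
      by simp
  next
    case 2
    then show ?thesis
      using insert_step_simps(2)[OF assms(1-5), of R] insert_step_simps(2)[OF assms(1-5), of R'] eq by simp
  next
    case 3
    then show ?thesis
      using insert_step_simps(1)[OF assms(1-5), of R] insert_step_simps(1)[OF assms(1-5), of R'] eq by simp
  qed (use out in blast)
qed

lemma sign_block_nonzero: "sign_block n ((j, i) # t) \<Longrightarrow> block_vec n ((j, i) # t) \<noteq> (\<lambda>_. 0)"
  using sign_block_tail_ends(3) by (metis less_irrefl)

text \<open>The first positive and the last negative position of the vector give
  \<open>pos j i\<close> and \<open>j\<close>, hence \<open>i\<close>. The insertion can then be
  undone, and the tail is determined by induction.\<close>

lemma sign_block_inject:
  assumes "sign_block n b" "sign_block n b'" "block_vec n b = block_vec n b'"
  shows "b = b'"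
  using assms
proof (induction b arbitrary: b')
  case Nil
  then have "block_vec n b' = (\<lambda>_. 0)" by simp
  then show ?case
    using Nil(2) by (metis sign_block_nonzero surj_pair list.exhaust)
next
  case (Cons ji t)
  obtain j i where ji: "ji = (j, i)" by fastforce
  have sb: "sign_block n ((j, i) # t)" using Cons ji by simp
  show ?case
  proof (cases b')
    case Nil
    then show ?thesis using Cons.prems sb ji by (metis sign_block_nonzero block_vec.simps(1))
  next
    case (Cons ji' t')
    obtain j' i' where ji': "ji' = (j', i')" by fastforce
    have sb': "sign_block n ((j', i') # t')" using Cons.prems Cons ji' by simp
    have eq: "block_vec n ((j, i) # t) = block_vec n ((j', i') # t')"
      using Cons.prems Cons ji ji' by simp
    have rng: "1 \<le> j" "j \<le> n + 1" "1 \<le> j'" "j' \<le> n + 1"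
        "1 \<le> pos j i" "pos j i \<le> n + 1" "pos j i \<noteq> j" "1 \<le> pos j' i'"
      using sb sb' pos_range[of j n i] pos_range[of j' n i'] by auto
    have "first_last n (pos j i) j (block_vec n ((j, i) # t))"
      using sb by simp
    moreover have "first_last n (pos j' i') j' (block_vec n ((j, i) # t))"
      unfolding eq using sb' by simp
    ultimately have "pos j i = pos j' i'" and j: "j = j'"
      using first_last_unique rng by blast+
    then have i: "i = i'" by (auto simp: pos_def split: if_splits)
    have "block_vec n t = block_vec n t'"
    proof (rule insert_step_inject[OF rng(5,6,1,2,7)])
      show "insert_step n (pos j i) j (block_vec n t) = insert_step n (pos j i) j (block_vec n t')"
        using eq i j by simp
    qed (simp add: block_vec_outside)
    then have "t = t'" using Cons.IH sb sb' by simp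
    then show ?thesis using i j ji ji' Cons by simp
  qed
qed

text \<open>In a step of kind \<open>raise_j\<close> the truncated \<open>n + 1 - j\<close> grows
  because \<open>sign_block\<close> bounds \<open>Suc j\<close> by \<open>n + 1\<close>.\<close>

lemma block_len_raise: "sign_block n b \<Longrightarrow> sign_block n b' \<Longrightarrow> raise b b' \<Longrightarrow> block_len n b' = block_len n b + 1"
  by (rotate_tac 2, induction rule: raise.induct) auto

lemma raise_length: "raise b b' \<Longrightarrow> length b' = length b"
  by (induction rule: raise.induct) auto

text \<open>For the pair \<open>(n + 1, 0)\<close> the relabelling is the identity on
  \<open>{2..n}\<close>, so the insertion is just the generator \<open>n + 1\<close>. The two sign
  hypotheses make its new end entries positive and negative.\<close>

lemma sign_block_Cons_top:
  assumes "2 \<le> n" "sign_block n b" "block_vec n b 1 \<le> 0" "0 \<le> block_vec n b (n + 1)"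
  shows "sign_block n ((n + 1, 0) # b)"
    and "block_vec n ((n + 1, 0) # b) = vec_act n (n + 1) (block_vec n b)"
    and "0 < gap n (n + 1) (block_vec n b)"
proof -
  have pos: "pos (n + 1) 0 = 1" using assms by (simp add: pos_def)
  show "block_vec n ((n + 1, 0) # b) = vec_act n (n + 1) (block_vec n b)"
    using assms(1) pos by (intro ext) (auto simp: insert_step_def vec_act_def rest_index_def block_vec_outside)
  then show "sign_block n ((n + 1, 0) # b)"
    using assms pos by (auto simp: first_last_def vec_act_def)
  show "0 < gap n (n + 1) (block_vec n b)" using assms by (simp add: gap_def)
qed

text \<open>If the inserted entries occupy both ends, the generator undoes the insertion. If they
  occupy neither, there is room for a further one. If exactly one end is occupied, the generator is
  the image of the generator \<open>n\<close> or \<open>1\<close> on the tail.\<close>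

lemma sign_block_top_moves:
  assumes n: "2 \<le> n" and sb: "sign_block n ((j, i) # t)"
  defines "c \<equiv> block_vec n ((j, i) # t)"
  shows "pos j i = 1 \<Longrightarrow> j = n + 1 \<Longrightarrow> vec_act n (n + 1) c = block_vec n t \<and> gap n (n + 1) c < 0"
    and "pos j i \<noteq> 1 \<Longrightarrow> j \<noteq> n + 1 \<Longrightarrow> c 1 \<le> 0 \<and> 0 \<le> c (n + 1)"
    and "pos j i = 1 \<longleftrightarrow> j \<noteq> n + 1 \<Longrightarrow> block_moves n ((j, i) # t) (vec_act n (n + 1) c) (gap n (n + 1) c)"
proof -
  define p where "p = pos j i"
  define R where "R = block_vec n t"
  have c: "c = insert_step n p j R" by (simp add: c_def p_def R_def)
  have rng: "1 \<le> j" "j \<le> n + 1" "i + 1 \<le> n" "1 \<le> p" "p \<le> n + 1" "p \<noteq> j" and sbt: "sign_block n t"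
    and fl: "first_last n p j c"
    using sb pos_range[of j n i] by (auto simp: p_def c_def)
  note at = insert_step_simps[OF rng(4,5,1,2,6), where R = R, folded c]
  show "vec_act n (n + 1) c = block_vec n t \<and> gap n (n + 1) c < 0" if "pos j i = 1" "j = n + 1"
  proof
    have p: "p = 1" using that p_def by simp
    show "vec_act n (n + 1) c = block_vec n t"
      using that(2) n unfolding c p R_def
      by (intro ext) (auto simp: insert_step_def vec_act_def rest_index_def block_vec_outside)
    show "gap n (n + 1) c < 0" using fl that(2) unfolding p first_last_def gap_def by auto
  qed
  show "c 1 \<le> 0 \<and> 0 \<le> c (n + 1)" if "pos j i \<noteq> 1" "j \<noteq> n + 1"
    using fl that rng unfolding p_def[symmetric] first_last_def by auto
  show "block_moves n ((j, i) # t) (vec_act n (n + 1) c) (gap n (n + 1) c)" if "pos j i = 1 \<longleftrightarrow> j \<noteq> n + 1"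
  proof (cases "p = 1")
    case True
    then have j: "j \<le> n" using that rng p_def by auto
    have N: "rest_index p j (n + 1) = n" using True j n by (auto simp: rest_index_def)
    have "R n = c (n + 1)" using at(3)[of "n + 1"] True j N n by auto
    then have g: "gap n n R = gap n (n + 1) c" using at(1) n True by (simp add: gap_def)
    have v: "insert_step n p j (vec_act n n R) = vec_act n (n + 1) c"
      using insert_step_act_last[of n p j R] True j n rng unfolding c
      by (auto simp: vec_act_def fun_eq_iff)
    have "0 \<le> c (n + 1)" "0 < c 1" "c j < 0" "\<And>x. j < x \<Longrightarrow> x \<le> n + 1 \<Longrightarrow> 0 \<le> c x"
      using fl j True by (auto simp: first_last_def)
    then have "first_last n p j (vec_act n (n + 1) c)"
      using True rng j by (auto simp: first_last_def vec_act_def)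
    moreover have "block_moves n t (vec_act n n R) (gap n (n + 1) c)"
      using sign_block_moves[OF n sbt, of n] n unfolding R_def[symmetric] g by simp
    ultimately show ?thesis
      using block_moves_Cons[of n t "vec_act n n R" "gap n (n + 1) c" j i] rng v
      by (simp add: p_def)
  next
    case False
    then have j: "j = n + 1" using that p_def by auto
    have N: "rest_index p j 1 = 2" using False rng j by (auto simp: rest_index_def)
    have "R 2 = c 1" using at(3)[of 1] False j N n by auto
    then have g: "gap n 1 R = gap n (n + 1) c" using at(2) n j by (simp add: gap_def numeral_2_eq_2)
    have v: "insert_step n p j (vec_act n 1 R) = vec_act n (n + 1) c"
      using insert_step_act_first[of n p j R] False j n rng unfolding c
      by (auto simp: vec_act_def fun_eq_iff)
    have "c 1 - 1 < 0" "0 < c p" "c j < 0" "\<And>x. 1 \<le> x \<Longrightarrow> x < p \<Longrightarrow> c x \<le> 0"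
      using fl j rng False unfolding first_last_def by force+
    then have "first_last n p j (vec_act n (n + 1) c)"
      using False rng j by (auto simp: first_last_def vec_act_def)
    moreover have "block_moves n t (vec_act n 1 R) (gap n (n + 1) c)"
      using sign_block_moves[OF n sbt, of 1] n unfolding R_def[symmetric] g by simp
    ultimately show ?thesis
      using block_moves_Cons[of n t "vec_act n 1 R" "gap n (n + 1) c" j i] rng v
      by (simp add: p_def)
  qed
qed

text \<open>A summary for the arguments on words, which need the new vector and length but not the
  shape of the new block.\<close>

lemma sign_block_act:
  assumes n: "2 \<le> n" and sb: "sign_block n b" and s: "1 \<le> s" "s \<le> n + 1"
  defines "c \<equiv> block_vec n b"
  shows "0 < gap n s c \<Longrightarrow> \<exists>b'. sign_block n b' \<and> block_vec n b' = vec_act n s c \<and> block_len n b' = block_len n b + 1"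
    and "gap n s c < 0 \<Longrightarrow> \<exists>b'. sign_block n b' \<and> block_vec n b' = vec_act n s c \<and> block_len n b = block_len n b' + 1"
proof -
  have *: "(0 < gap n s c \<longrightarrow> (\<exists>b'. sign_block n b' \<and> block_vec n b' = vec_act n s c \<and> block_len n b' = block_len n b + 1)) \<and>
    (gap n s c < 0 \<longrightarrow> (\<exists>b'. sign_block n b' \<and> block_vec n b' = vec_act n s c \<and> block_len n b = block_len n b' + 1))"
    (is ?P)
  proof -
    have moves: ?P if "block_moves n b (vec_act n s c) (gap n s c)"
      using that sb unfolding block_moves_def by (metis block_len_raise)
    show ?thesis
    proof (cases "s = n + 1")
      case False
      then show ?thesis using moves sign_block_moves[OF n sb] s c_def by simp
    next
      case s: True
      have top: ?P if "c 1 \<le> 0 \<and> 0 \<le> c (n + 1)"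
        using sign_block_Cons_top[OF n sb] that unfolding c_def s
        by (auto simp del: block_vec.simps sign_block.simps intro!: exI[of _ "(n + 1, 0) # b"])
      show ?thesis
      proof (cases b)
        case Nil
        then show ?thesis using top by (simp add: c_def)
      next
        case (Cons ji t)
        obtain j i where ji: "ji = (j, i)" by fastforce
        note b = Cons[unfolded ji]
        note m = sign_block_top_moves[OF n sb[unfolded b], folded b, folded c_def]
        consider "pos j i = 1" "j = n + 1" | "pos j i \<noteq> 1" "j \<noteq> n + 1" | "pos j i = 1 \<longleftrightarrow> j \<noteq> n + 1"
          by blast
        then show ?thesis
        proof cases
          case 1
          then have "i = 0" using n by (simp add: pos_def split: if_splits)
          then show ?thesis using m(1)[OF 1] sb 1 unfolding s b by (auto intro!: exI[of _ t])
        next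
          case 2
          then show ?thesis using top m(2) by blast
        next
          case 3
          then show ?thesis using moves m(3) s by blast
        qed
      qed
    qed
  qed
  show "0 < gap n s c \<Longrightarrow> \<exists>b'. sign_block n b' \<and> block_vec n b' = vec_act n s c \<and> block_len n b' = block_len n b + 1"
    and "gap n s c < 0 \<Longrightarrow> \<exists>b'. sign_block n b' \<and> block_vec n b' = vec_act n s c \<and> block_len n b = block_len n b' + 1"
    using * by blast+
qed

section \<open>Affine blocks as sign conditions\<close>

fun chained :: "nat \<Rightarrow> (nat \<times> nat) \<Rightarrow> (nat \<times> nat) \<Rightarrow> bool" where
  "chained n (j, i) (j', i') \<longleftrightarrow>
     (i' = 0 \<and> j' = 1 \<or> 1 \<le> i' \<and> i' \<le> n - 1 \<and> 1 \<le> j' \<and> j' \<le> n) \<and>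
     j' \<le> j \<and> i \<le> i' \<and> (i + 1 < j \<longrightarrow> j' < j) \<and> (i' + 1 < j' \<longrightarrow> i < i')"

lemma chained_conv:
  "chained n x y \<longleftrightarrow>
     (snd y = 0 \<and> fst y = 1 \<or> 1 \<le> snd y \<and> snd y \<le> n - 1 \<and> 1 \<le> fst y \<and> fst y \<le> n) \<and>
     fst y \<le> fst x \<and> snd x \<le> snd y \<and> (fst x > snd x + 1 \<longrightarrow> fst y < fst x) \<and>
     (fst y > snd y + 1 \<longrightarrow> snd y > snd x)"
  by (cases x; cases y) auto

lemma affine_block_Nil: "affine_block n []"
  by (simp add: affine_block_def)

lemma affine_block_singleton:
  "affine_block n [(j, i)] \<longleftrightarrow> 1 \<le> j \<and> j \<le> n + 1 \<and> i \<le> n - 1"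
  by (simp add: affine_block_def jj_def ii_def)

text \<open>Turns the definition by indices into a recursion on lists. The range condition in
  \<open>chained\<close> is what lets the tail be a block by itself.\<close>

lemma affine_block_Cons_Cons:
  "affine_block n ((j, i) # (j', i') # b) \<longleftrightarrow>
     1 \<le> j \<and> j \<le> n + 1 \<and> i \<le> n - 1 \<and> chained n (j, i) (j', i') \<and> affine_block n ((j', i') # b)"
proof -
  let ?l = "(j', i') # b"
  have chain: "affine_block n (x # l) \<longleftrightarrow>
      1 \<le> fst x \<and> fst x \<le> n + 1 \<and> snd x \<le> n - 1 \<and> (\<forall>s < length l. chained n ((x # l) ! s) (l ! s))" for x l
  proof -
    have "(\<forall>s\<in>{2..length (x # l)}. P s) \<longleftrightarrow> (\<forall>s < length l. P (s + 2))" for P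
    proof (intro iffI allI ballI impI)
      fix s assume P: "\<forall>s < length l. P (s + 2)" and s: "s \<in> {2..length (x # l)}"
      then have "s - 2 < length l" "s = (s - 2) + 2" by auto
      then show "P s" using P by metis
    qed auto
    then show ?thesis
      unfolding affine_block_def chained_conv by (simp add: jj_def ii_def)
  qed
  have "(\<forall>s < length ?l. chained n (((j, i) # ?l) ! s) (?l ! s)) \<longleftrightarrow>
      chained n (j, i) (j', i') \<and> (\<forall>s < length b. chained n (?l ! s) (b ! s))"
    using less_Suc_eq_0_disj by auto
  then show ?thesis
    unfolding chain by auto
qed

text \<open>The inserted entries account for \<open>R 1\<close> and \<open>R (n + 1)\<close>. The
  other positions before \<open>p\<close> carry \<open>R 2, ..., R (i + 1)\<close>; the other
  positions after \<open>j\<close> carry the entries of \<open>R\<close> from index \<open>j\<close>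
  on if \<open>p\<close> precedes \<open>j\<close>, and from \<open>j + 1\<close> on
  otherwise.\<close>

lemma first_last_insert_step:
  assumes "1 \<le> j" "j \<le> n + 1" "i + 1 \<le> n"
  shows "first_last n (pos j i) j (insert_step n (pos j i) j R) \<longleftrightarrow>
    (\<forall>y. 1 \<le> y \<and> y \<le> i + 1 \<longrightarrow> R y \<le> 0) \<and>
    (\<forall>y. (if i + 1 < j then j else j + 1) \<le> y \<and> y \<le> n + 1 \<longrightarrow> 0 \<le> R y)"
proof -
  define p where "p = pos j i"
  have rng: "1 \<le> p" "p \<le> n + 1" "p \<noteq> j" using pos_range[of j n i] assms by (auto simp: p_def)
  note at = insert_step_simps[OF rng(1,2) assms(1,2) rng(3), where R = R]
  show ?thesis
  proof
    assume fl: "first_last n (pos j i) j (insert_step n (pos j i) j R)"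
    have low: "R y \<le> 0" if "1 \<le> y" "y \<le> i + 1" for y
    proof (cases "y = 1")
      case True
      then show ?thesis using fl at(2) by (simp add: first_last_def p_def)
    next
      case False
      then have "2 \<le> y" "y \<le> n" using that assms by auto
      then obtain x where x: "1 \<le> x" "x \<le> n + 1" "x \<noteq> p" "x \<noteq> j" "rest_index p j x = y"
        by (metis rest_index_surj[OF rng(1,2) assms(1,2) rng(3)])
      then have "x < p" using that by (auto simp: rest_index_def p_def pos_def split: if_splits)
      then have "insert_step n p j R x \<le> 0" using fl x by (simp add: first_last_def p_def)
      then show ?thesis using at(3)[of x] x by simp
    qed
    have high: "0 \<le> R y" if "(if i + 1 < j then j else j + 1) \<le> y" "y \<le> n + 1" for y
    proof (cases "y = n + 1")
      case True
      then show ?thesis using fl at(1) by (simp add: first_last_def p_def)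
    next
      case False
      have "2 \<le> y" "y \<le> n" using that False assms by (auto split: if_splits)
      then obtain x where x: "1 \<le> x" "x \<le> n + 1" "x \<noteq> p" "x \<noteq> j" "rest_index p j x = y"
        by (metis rest_index_surj[OF rng(1,2) assms(1,2) rng(3)])
      then have "j < x" using that by (auto simp: rest_index_def p_def pos_def split: if_splits)
      then have "0 \<le> insert_step n p j R x" using fl x by (simp add: first_last_def p_def)
      then show ?thesis using at(3)[of x] x by simp
    qed
    show "(\<forall>y. 1 \<le> y \<and> y \<le> i + 1 \<longrightarrow> R y \<le> 0) \<and>
      (\<forall>y. (if i + 1 < j then j else j + 1) \<le> y \<and> y \<le> n + 1 \<longrightarrow> 0 \<le> R y)"
      using low high by blast
  next
    assume R: "(\<forall>y. 1 \<le> y \<and> y \<le> i + 1 \<longrightarrow> R y \<le> 0) \<and>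
      (\<forall>y. (if i + 1 < j then j else j + 1) \<le> y \<and> y \<le> n + 1 \<longrightarrow> 0 \<le> R y)"
    have "insert_step n p j R x \<le> 0" if "1 \<le> x" "x < p" for x
    proof (cases "x = j")
      case True
      have "R 1 \<le> 0" using R by simp
      then show ?thesis using at(2) True by simp
    next
      case False
      then have "1 \<le> rest_index p j x" "rest_index p j x \<le> i + 1"
        using that by (auto simp: rest_index_def p_def pos_def split: if_splits)
      then show ?thesis using R at(3)[of x] that rng False by auto
    qed
    moreover have "0 \<le> insert_step n p j R x" if "j < x" "x \<le> n + 1" for x
    proof (cases "x = p")
      case True
      have "0 \<le> R (n + 1)" using R assms by simp
      then show ?thesis using at(1) True by simp
    next
      case False
      then have "(if i + 1 < j then j else j + 1) \<le> rest_index p j x" "rest_index p j x \<le> n + 1"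
        using that rest_index_bounds[of p n j x] rng assms by (auto simp: rest_index_def p_def pos_def split: if_splits)
      then show ?thesis using R at(3)[of x] that rng False assms by auto
    qed
    moreover have "0 \<le> R (n + 1)" "R 1 \<le> 0" using R assms by auto
    ultimately show "first_last n (pos j i) j (insert_step n (pos j i) j R)"
      using at(1,2) unfolding p_def[symmetric] first_last_def by auto
  qed
qed

text \<open>With \<open>p'\<close> the first positive and \<open>j'\<close> the last negative
  position of the tail, the conditions on the tail read \<open>i + 1 < p'\<close> and
  \<open>j' < j\<close>, or \<open>j' \<le> j\<close> if \<open>j \<le> i + 1\<close>. Unfolding
  \<open>p' = pos j' i'\<close> gives the weak inequalities between the pairs together with their
  strict variants.\<close>

lemma first_last_insert_step_chained:
  assumes "1 \<le> j" "j \<le> n + 1" "i + 1 \<le> n" and sb: "sign_block n ((j', i') # b)"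
  shows "first_last n (pos j i) j (insert_step n (pos j i) j (block_vec n ((j', i') # b))) \<longleftrightarrow>
    chained n (j, i) (j', i')"
proof -
  define R where "R = block_vec n ((j', i') # b)"
  define p' where "p' = pos j' i'"
  have fl: "R p' > 0" "R j' < 0" "\<And>x. 1 \<le> x \<Longrightarrow> x < p' \<Longrightarrow> R x \<le> 0" "\<And>x. j' < x \<Longrightarrow> x \<le> n + 1 \<Longrightarrow> 0 \<le> R x"
    and rng: "1 \<le> j'" "j' \<le> n + 1" "i' + 1 \<le> n" "1 \<le> p'" "p' \<le> n + 1"
    using sb pos_range[of j' n i'] by (auto simp: R_def p'_def first_last_def)
  have "(\<forall>y. 1 \<le> y \<and> y \<le> i + 1 \<longrightarrow> R y \<le> 0) \<longleftrightarrow> i + 1 < p'"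
    using fl(1,3) rng by (metis le_less_trans not_less)
  moreover have "(\<forall>y. (if i + 1 < j then j else j + 1) \<le> y \<and> y \<le> n + 1 \<longrightarrow> 0 \<le> R y) \<longleftrightarrow>
      j' < (if i + 1 < j then j else j + 1)"
    using fl(2,4) rng by (metis less_le_trans not_less)
  ultimately show ?thesis
    unfolding R_def[symmetric] first_last_insert_step[OF assms(1-3)] using rng assms(1-3)
    by (auto simp: p'_def pos_def split: if_splits)
qed

lemma affine_block_iff_sign_block:
  assumes "2 \<le> n"
  shows "affine_block n b \<longleftrightarrow> sign_block n b"
proof (induction b)
  case Nil
  then show ?case by (simp add: affine_block_Nil)
next
  case (Cons ji b)
  obtain j i where ji: "ji = (j, i)" by fastforce
  show ?case
  proof (cases b)
    case Nil
    have "first_last n (pos j i) j (insert_step n (pos j i) j (\<lambda>_. 0))" if "1 \<le> j" "j \<le> n + 1" "i + 1 \<le> n"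
      using first_last_insert_step[OF that] by simp
    then show ?thesis using assms by (auto simp: ji Nil affine_block_singleton)
  next
    case (Cons ji' t)
    obtain j' i' where ji': "ji' = (j', i')" by fastforce
    have "i \<le> n - 1 \<longleftrightarrow> i + 1 \<le> n" using assms by auto
    then show ?thesis
      using first_last_insert_step_chained[of j n i j' i' t] Cons.IH
      unfolding ji Cons ji' affine_block_Cons_Cons sign_block.simps(2)[of n j i] block_vec.simps(2)[of n j i] by blast
  qed
qed

text \<open>Both directions come with the same \<open>r\<close>, because the step is read backwards
  when the length drops.\<close>

lemma raise_differ_at:
  assumes "raise b b'"
  shows "\<exists>r. differ_at b b' r \<and> differ_at b' b r \<and> (jj b' r + 1 = jj b r \<or> ii b' r = ii b r + 1)"
  using assms
proof (induction rule: raise.induct)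
  case (raise_j j i b)
  show ?case by (rule exI[of _ 1]) (auto simp: differ_at_def jj_def ii_def nth_Cons')
next
  case (raise_i j i b)
  show ?case by (rule exI[of _ 1]) (auto simp: differ_at_def jj_def ii_def nth_Cons')
next
  case (raise_Cons b b' x)
  then obtain r where r: "differ_at b b' r" "differ_at b' b r" "jj b' r + 1 = jj b r \<or> ii b' r = ii b r + 1"
    by blast
  have shift: "jj (x # l) (Suc t) = jj l t" "ii (x # l) (Suc t) = ii l t" if "1 \<le> t" for t l
    using that by (auto simp: jj_def ii_def nth_Cons')
  have "differ_at (x # l) (x # l') (Suc r)" if "differ_at l l' r" for l l'
    unfolding differ_at_def
  proof (intro conjI ballI impI)
    fix t assume "t \<in> {1..length (x # l)}" "t \<noteq> Suc r"
    then have "t = 1 \<or> (\<exists>u. t = Suc u \<and> 1 \<le> u \<and> u \<le> length l \<and> u \<noteq> r)"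
      by (cases t) auto
    then show "jj (x # l') t = jj (x # l) t" "ii (x # l') t = ii (x # l) t"
      using that shift by (auto simp: differ_at_def) (simp_all add: jj_def ii_def)
  qed (use that shift in \<open>auto simp: differ_at_def\<close>)
  moreover have "1 \<le> r" using r by (simp add: differ_at_def)
  ultimately show ?case using r shift by (intro exI[of _ "Suc r"]) auto
qed

section \<open>Words and the Coxeter group\<close>

definition word_act :: "nat \<Rightarrow> nat list \<Rightarrow> (nat \<Rightarrow> int) \<Rightarrow> nat \<Rightarrow> int" where
  "word_act n u c = foldr (vec_act n) u c"

lemma word_act_simps [simp]:
  "word_act n [] c = c"
  "word_act n (s # u) c = vec_act n s (word_act n u c)"
  "word_act n (u @ v) c = word_act n u (word_act n v c)"
  by (simp_all add: word_act_def)

lemma word_act_down: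
  assumes "i \<le> n"
  shows "word_act n (down_word i 1) c x =
    (if x = i + 1 then c 1 else if 1 \<le> x \<and> x \<le> i then c (x + 1) else c x)"
  using assms
proof (induction i arbitrary: x)
  case 0
  then show ?case by (simp add: down_word_def)
next
  case (Suc i)
  have "down_word (Suc i) 1 = Suc i # down_word i 1" by (simp add: down_word_def)
  moreover have "word_act n (down_word i 1) c y =
      (if y = i + 1 then c 1 else if 1 \<le> y \<and> y \<le> i then c (y + 1) else c y)" for y
    using Suc by simp
  ultimately show ?case
    using Suc.prems by (auto simp: vec_act_def)
qed

lemma word_act_up:
  assumes "1 \<le> j" "j \<le> n + 1"
  shows "word_act n (up_word j n) c x =
    (if x = j then c (n + 1) else if j < x \<and> x \<le> n + 1 then c (x - 1) else c x)"
  using assms(2,1)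
proof (induction arbitrary: x rule: inc_induct)
  case base
  then show ?case by (simp add: up_word_def)
next
  case (step j)
  have "up_word j n = j # up_word (Suc j) n" using step by (simp add: up_word_def upt_conv_Cons)
  moreover have "word_act n (up_word (Suc j) n) c y =
      (if y = Suc j then c (n + 1) else if Suc j < y \<and> y \<le> n + 1 then c (y - 1) else c y)" for y
    using step by simp
  ultimately show ?case
    using step.hyps by (auto simp: vec_act_def)
qed

text \<open>The letter \<open>n + 1\<close> creates the two new end entries. The descending word
  carries the first one to position \<open>i + 1\<close>, and the ascending word carries the last
  one to \<open>j\<close>, pushing the other one to \<open>i + 2\<close> if
  \<open>j \<le> i + 1\<close>. This explains the two branches of \<open>pos\<close>.\<close>

lemma word_act_B_word:
  assumes "1 \<le> j" "j \<le> n + 1" "i + 1 \<le> n" "\<And>x. x < 1 \<or> n + 1 < x \<Longrightarrow> R x = 0"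
  shows "word_act n (B_word n j i) R = insert_step n (pos j i) j R"
proof
  fix x
  have "word_act n (B_word n j i) R x =
      (let R' = vec_act n (n + 1) R;
           R'' = (\<lambda>x. if x = i + 1 then R' 1 else if 1 \<le> x \<and> x \<le> i then R' (x + 1) else R' x)
       in if x = j then R'' (n + 1) else if j < x \<and> x \<le> n + 1 then R'' (x - 1) else R'' x)"
    using word_act_up[OF assms(1,2), of "word_act n (down_word i 1) (vec_act n (n + 1) R)" x]
      word_act_down[of i n "vec_act n (n + 1) R"] assms(3)
    by (simp add: B_word_def h_word_def Let_def)
  also have "\<dots> = insert_step n (pos j i) j R x"
  proof (cases "i + 1 < j")
    case True
    then show ?thesis
      using assms by (auto simp: Let_def insert_step_def vec_act_def rest_index_def pos_def)
  next
    case False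
    then show ?thesis
      using assms by (auto simp: Let_def insert_step_def vec_act_def rest_index_def pos_def)
  qed
  finally show "word_act n (B_word n j i) R x = insert_step n (pos j i) j R x" .
qed

lemma block_word_Cons: "block_word n ((j, i) # b) = B_word n j i @ block_word n b"
  by (simp add: block_word_def)

lemma block_word_Nil: "block_word n [] = []"
  by (simp add: block_word_def)

lemma word_act_block_word:
  "sign_block n b \<Longrightarrow> word_act n (block_word n b) (\<lambda>_. 0) = block_vec n b"
proof (induction b)
  case Nil
  then show ?case by (simp add: block_word_Nil)
next
  case (Cons ji b)
  obtain j i where ji: "ji = (j, i)" by fastforce
  have "word_act n (B_word n j i) (block_vec n b) = insert_step n (pos j i) j (block_vec n b)"
    using Cons.prems ji by (intro word_act_B_word block_vec_outside) auto
  then show ?case using Cons ji by (simp add: block_word_Cons)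
qed

lemma set_h_word: "1 \<le> j \<Longrightarrow> i \<le> n \<Longrightarrow> set (h_word n j i) \<subseteq> {1..n}"
  by (auto simp: h_word_def up_word_def down_word_def)

lemma length_h_word: "1 \<le> j \<Longrightarrow> j \<le> n + 1 \<Longrightarrow> length (h_word n j i) = (n + 1 - j) + i"
  by (cases i) (auto simp: h_word_def up_word_def down_word_def)

lemma block_word_lists: "sign_block n b \<Longrightarrow> block_word n b \<in> lists (aff_gens n)"
proof (induction b)
  case Nil
  then show ?case by (simp add: block_word_Nil)
next
  case (Cons ji b)
  obtain j i where ji: "ji = (j, i)" by fastforce
  have "set (h_word n j i) \<subseteq> {1..n}" using set_h_word[of j i n] Cons.prems ji by auto
  then show ?case
    using Cons ji by (auto simp: block_word_Cons B_word_def aff_gens_def in_lists_conv_set)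
qed

lemma length_block_word: "sign_block n b \<Longrightarrow> length (block_word n b) = block_len n b"
proof (induction b)
  case Nil
  then show ?case by (simp add: block_word_Nil)
next
  case (Cons ji b)
  then show ?case
    by (cases ji) (simp add: block_word_Cons B_word_def length_h_word)
qed

text \<open>The reflection formulas for affine simple roots, with Cartan integers 2, -1 and
  0.\<close>

lemma gap_act:
  assumes "2 \<le> n" "s \<in> aff_gens n" "t \<in> aff_gens n"
  shows "gap n s (vec_act n s c) = - gap n s c"
    and "aff_adjacent n s t \<Longrightarrow> gap n t (vec_act n s c) = gap n t c + gap n s c"
    and "s \<noteq> t \<Longrightarrow> \<not> aff_adjacent n s t \<Longrightarrow> gap n t (vec_act n s c) = gap n t c"
proof -
  have st: "1 \<le> s" "s \<le> n + 1" "1 \<le> t" "t \<le> n + 1" using assms by (auto simp: aff_gens_def)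
  show "gap n s (vec_act n s c) = - gap n s c"
    using assms(1) st by (auto simp: gap_def vec_act_def)
  show "gap n t (vec_act n s c) = gap n t c + gap n s c" if "aff_adjacent n s t"
    using that unfolding aff_adjacent_def
    by (elim disjE conjE) (use assms(1) st in \<open>auto simp: gap_def vec_act_def\<close>)
  show "gap n t (vec_act n s c) = gap n t c" if "s \<noteq> t" "\<not> aff_adjacent n s t"
    using that assms(1) st unfolding aff_adjacent_def by (auto simp: gap_def vec_act_def)
qed

lemma vec_act_gap_0: "2 \<le> n \<Longrightarrow> s \<in> aff_gens n \<Longrightarrow> gap n s c = 0 \<Longrightarrow> vec_act n s c = c"
  by (auto simp: gap_def vec_act_def aff_gens_def fun_eq_iff split: if_splits)

lemma vec_act_braid:
  assumes "2 \<le> n" "s \<in> aff_gens n" "t \<in> aff_gens n" "aff_adjacent n s t"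
  shows "vec_act n s (vec_act n t (vec_act n s c)) = vec_act n t (vec_act n s (vec_act n t c))"
proof -
  have up: "vec_act n s (vec_act n t (vec_act n s c)) = vec_act n t (vec_act n s (vec_act n t c))"
    if "t = s + 1" "1 \<le> s" "t \<le> n" for s t
    using that by (intro ext) (simp add: vec_act_def)
  have last: "vec_act n s (vec_act n t (vec_act n s c)) = vec_act n t (vec_act n s (vec_act n t c))"
    if "s = n" "t = n + 1" for s t
    using that assms(1) by (intro ext) (simp add: vec_act_def)
  have top: "vec_act n s (vec_act n t (vec_act n s c)) = vec_act n t (vec_act n s (vec_act n t c))"
    if "s = n + 1" "t = 1" for s t
    using that assms(1) by (intro ext) (simp add: vec_act_def)
  have "t = s + 1 \<and> t \<le> n \<or> s = n \<and> t = n + 1 \<or> s = t + 1 \<and> s \<le> n \<or> t = n \<and> s = n + 1 \<or>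
      s = n + 1 \<and> t = 1 \<or> s = 1 \<and> t = n + 1" "1 \<le> s" "1 \<le> t"
    using assms by (auto simp: aff_adjacent_def aff_gens_def)
  then show ?thesis
    using up[of t s] up[of s t] last[of t s] last[of s t] top[of t s] top[of s t] by metis
qed

lemma vec_act_commute:
  assumes "2 \<le> n" "s \<in> aff_gens n" "t \<in> aff_gens n" "s \<noteq> t" "\<not> aff_adjacent n s t"
  shows "vec_act n s (vec_act n t c) = vec_act n t (vec_act n s c)"
proof -
  have inner: "vec_act n s (vec_act n t c) = vec_act n t (vec_act n s c)"
    if "s + 1 < t" "t \<le> n" for s t
    using that by (intro ext) (simp add: vec_act_def)
  have top: "vec_act n s (vec_act n t c) = vec_act n t (vec_act n s c)"
    if "1 < s" "s < n" "t = n + 1" for s t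
    using that by (intro ext) (simp add: vec_act_def)
  have "s + 1 < t \<and> t \<le> n \<or> t + 1 < s \<and> s \<le> n \<or> 1 < s \<and> s < n \<and> t = n + 1 \<or> 1 < t \<and> t < n \<and> s = n + 1"
    using assms unfolding aff_adjacent_def aff_gens_def by simp linarith
  then show ?thesis
    using inner[of t s] inner[of s t] top[of t s] top[of s t] by metis
qed

lemma aff_adjacent_sym: "aff_adjacent n s t \<longleftrightarrow> aff_adjacent n t s"
  by (auto simp: aff_adjacent_def)

lemma word_act_relator:
  assumes "2 \<le> n" "s \<in> aff_gens n" "t \<in> aff_gens n"
  shows "word_act n (concat (replicate (aff_matrix n s t) [s, t])) c = c"
proof -
  have inv: "vec_act n r (vec_act n r d) = d" for r d using assms by (simp add: vec_act_vec_act)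
  consider "s = t" | "s \<noteq> t" "aff_adjacent n s t" | "s \<noteq> t" "\<not> aff_adjacent n s t" by blast
  then show ?thesis
  proof cases
    case 2
    have "vec_act n s (vec_act n t (vec_act n s (vec_act n t (vec_act n s (vec_act n t c))))) = c"
      using vec_act_braid[OF assms 2(2), of "vec_act n t (vec_act n s (vec_act n t c))"] inv by simp
    then show ?thesis using 2 by (simp add: aff_matrix_def numeral_3_eq_3)
  next
    case 3
    then show ?thesis
      using vec_act_commute[OF assms 3, of "vec_act n s (vec_act n t c)"] inv
      by (simp add: aff_matrix_def numeral_2_eq_2)
  qed (simp add: aff_matrix_def inv)
qed

section \<open>Coxeter group elements as classes of words\<close>

lemma cox_eq_lists: "cox_eq S M u v \<Longrightarrow> u \<in> lists S \<and> v \<in> lists S"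
proof (induction rule: cox_eq.induct)
  case (relator u v s t)
  have "set (concat (replicate k [s, t])) \<subseteq> S" for k using relator by auto
  then show ?case using relator by (auto simp: in_lists_conv_set)
qed auto

lemma cox_eq_cong:
  assumes "cox_eq S M u v" "a \<in> lists S" "b \<in> lists S"
  shows "cox_eq S M (a @ u @ b) (a @ v @ b)"
  using assms(1)
proof (induction rule: cox_eq.induct)
  case (relator u v s t)
  then show ?case
    using cox_eq.relator[of "a @ u" S "v @ b" s t M] assms by simp
next
  case (refl u)
  then show ?case using assms by (intro cox_eq.refl) simp
qed (blast intro: cox_eq.sym cox_eq.trans)+

text \<open>The vector \<open>c\<close> is arbitrary and need not lie in the orbit of zero: later,
  suitable test vectors tell elements apart.\<close>

lemma word_act_cox_eq:
  assumes "2 \<le> n" "cox_eq (aff_gens n) (aff_matrix n) u v"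
  shows "word_act n u c = word_act n v c"
  using assms(2)
  by (induction arbitrary: c rule: cox_eq.induct) (simp_all add: word_act_relator[OF assms(1)])

lemma cox_eq_Cons:
  "cox_eq S M u v \<Longrightarrow> s \<in> S \<Longrightarrow> cox_eq S M (s # u) (s # v)"
  using cox_eq_cong[of S M u v "[s]" "[]"] by simp

lemma cox_eq_append:
  "cox_eq S M u v \<Longrightarrow> b \<in> lists S \<Longrightarrow> cox_eq S M (u @ b) (v @ b)"
  using cox_eq_cong[of S M u v "[]" b] by simp

lemma cox_eq_square:
  assumes "M s s = 1" "s \<in> S" "u \<in> lists S"
  shows "cox_eq S M (s # s # u) u"
  using cox_eq.relator[of "[]" S u s s M] assms by simp

text \<open>Putting the relator \<open>s t s t\<close> in front of \<open>t s u\<close> and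
  cancelling squares from the inside leaves \<open>s t u\<close>. The braid relation is obtained
  likewise.\<close>

lemma cox_eq_commute:
  assumes "M s t = 2" "M t t = 1" "M s s = 1" "s \<in> S" "t \<in> S" "u \<in> lists S"
  shows "cox_eq S M (s # t # u) (t # s # u)"
proof -
  have "cox_eq S M (s # t # s # t # t # s # u) (t # s # u)"
    using cox_eq.relator[of "[]" S "t # s # u" s t M] assms by (simp add: numeral_2_eq_2)
  moreover have "cox_eq S M (s # t # s # t # t # s # u) (s # t # s # s # u)"
    using assms by (intro cox_eq_Cons cox_eq_square) auto
  moreover have "cox_eq S M (s # t # s # s # u) (s # t # u)"
    using assms by (intro cox_eq_Cons cox_eq_square) auto
  ultimately show ?thesis by (meson cox_eq.sym cox_eq.trans)
qed

lemma cox_eq_braid: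
  assumes "M s t = 3" "M t t = 1" "M s s = 1" "s \<in> S" "t \<in> S" "u \<in> lists S"
  shows "cox_eq S M (s # t # s # u) (t # s # t # u)"
proof -
  have "cox_eq S M (s # t # s # t # s # t # t # s # t # u) (t # s # t # u)"
    using cox_eq.relator[of "[]" S "t # s # t # u" s t M] assms by (simp add: numeral_3_eq_3)
  moreover have "cox_eq S M (s # t # s # t # s # t # t # s # t # u) (s # t # s # t # s # s # t # u)"
    using assms by (intro cox_eq_Cons cox_eq_square) auto
  moreover have "cox_eq S M (s # t # s # t # s # s # t # u) (s # t # s # t # t # u)"
    using assms by (intro cox_eq_Cons cox_eq_square) auto
  moreover have "cox_eq S M (s # t # s # t # t # u) (s # t # s # u)"
    using assms by (intro cox_eq_Cons cox_eq_square) auto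
  ultimately show ?thesis by (meson cox_eq.sym cox_eq.trans)
qed

lemma cox_elem_eq_iff:
  assumes "u \<in> lists S"
  shows "cox_elem S M u = cox_elem S M v \<longleftrightarrow> cox_eq S M u v"
proof
  assume "cox_elem S M u = cox_elem S M v"
  then have "u \<in> cox_elem S M v"
    using cox_eq.refl[OF assms, of M] by (auto simp: cox_elem_def cox_rel_def)
  then show "cox_eq S M u v" by (auto simp: cox_elem_def cox_rel_def intro: cox_eq.sym)
next
  assume "cox_eq S M u v"
  then show "cox_elem S M u = cox_elem S M v"
    by (auto simp: cox_elem_def cox_rel_def intro: cox_eq.sym cox_eq.trans)
qed

lemma
  shows carrier_cox_group: "carrier (cox_group S M) = cox_elem S M ` lists S"
    and one_cox_group: "\<one>\<^bsub>cox_group S M\<^esub> = cox_elem S M []"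
  by (auto simp: cox_group_def quotient_def cox_elem_def)

text \<open>All products of representatives lie in one class, so the union that defines the product
  collapses to that class.\<close>

lemma mult_cox_group:
  assumes "u \<in> lists S" "v \<in> lists S"
  shows "cox_elem S M u \<otimes>\<^bsub>cox_group S M\<^esub> cox_elem S M v = cox_elem S M (u @ v)"
proof -
  have eq: "cox_elem S M (u' @ v') = cox_elem S M (u @ v)" if "u' \<in> cox_elem S M u" "v' \<in> cox_elem S M v" for u' v'
  proof -
    have u': "cox_eq S M u u'" and v': "cox_eq S M v v'" using that by (auto simp: cox_elem_def cox_rel_def)
    have "cox_eq S M (u @ v) (u' @ v)" using cox_eq_append[OF u' assms(2)] .
    moreover have "cox_eq S M (u' @ v) (u' @ v')"
      using cox_eq_cong[OF v', of u' "[]"] cox_eq_lists[OF u'] by simp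
    ultimately have "cox_eq S M (u @ v) (u' @ v')" by (rule cox_eq.trans)
    then show ?thesis using assms by (simp add: cox_elem_eq_iff[symmetric])
  qed
  have "(\<Union>u'\<in>cox_elem S M u. \<Union>v'\<in>cox_elem S M v. cox_elem S M (u' @ v')) =
      (\<Union>u'\<in>cox_elem S M u. \<Union>v'\<in>cox_elem S M v. cox_elem S M (u @ v))"
    by (rule SUP_cong[OF HOL.refl], rule SUP_cong[OF HOL.refl], rule eq)
  moreover have "u \<in> cox_elem S M u" "v \<in> cox_elem S M v"
    using cox_eq.refl[OF assms(1)] cox_eq.refl[OF assms(2)] by (simp_all add: cox_elem_def cox_rel_def)
  then have "(\<Union>u'\<in>cox_elem S M u. \<Union>v'\<in>cox_elem S M v. cox_elem S M (u @ v)) = cox_elem S M (u @ v)"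
    by blast
  ultimately show ?thesis by (simp add: cox_group_def)
qed

text \<open>The inverse is a definite description: the square relation gives existence, and
  prefixing \<open>s\<close> to a word equation \<open>s u = 1\<close> gives uniqueness.\<close>

lemma inv_cox_generator:
  assumes "M s s = 1" "s \<in> S"
  shows "inv\<^bsub>cox_group S M\<^esub> cox_elem S M [s] = cox_elem S M [s]"
proof -
  have sq: "cox_elem S M [s, s] = cox_elem S M []"
    using cox_eq_square[of M s S "[]", OF assms] assms by (simp add: cox_elem_eq_iff)
  show ?thesis
    unfolding m_inv_def
  proof (rule the_equality)
    show "cox_elem S M [s] \<in> carrier (cox_group S M) \<and>
      cox_elem S M [s] \<otimes>\<^bsub>cox_group S M\<^esub> cox_elem S M [s] = \<one>\<^bsub>cox_group S M\<^esub> \<and>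
      cox_elem S M [s] \<otimes>\<^bsub>cox_group S M\<^esub> cox_elem S M [s] = \<one>\<^bsub>cox_group S M\<^esub>"
      using assms sq by (simp add: carrier_cox_group mult_cox_group one_cox_group)
  next
    fix y assume y: "y \<in> carrier (cox_group S M) \<and>
      cox_elem S M [s] \<otimes>\<^bsub>cox_group S M\<^esub> y = \<one>\<^bsub>cox_group S M\<^esub> \<and>
      y \<otimes>\<^bsub>cox_group S M\<^esub> cox_elem S M [s] = \<one>\<^bsub>cox_group S M\<^esub>"
    then obtain u where u: "u \<in> lists S" "y = cox_elem S M u" by (auto simp: carrier_cox_group)
    then have "cox_eq S M (s # u) []"
      using y assms mult_cox_group[of "[s]" S u M] by (simp add: one_cox_group cox_elem_eq_iff)
    then have "cox_eq S M (s # s # u) [s]" using cox_eq_Cons assms by fastforce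
    then have "cox_eq S M u [s]"
      using cox_eq_square[of M s S u, OF assms u(1)] by (meson cox_eq.sym cox_eq.trans)
    then show "y = cox_elem S M [s]" using u by (simp add: cox_elem_eq_iff)
  qed
qed

text \<open>Generators are their own inverses, so closing under inverses adds nothing to the values
  of words.\<close>

lemma parabolic_conv:
  assumes "\<And>s. s \<in> S \<Longrightarrow> M s s = 1" "J \<subseteq> S"
  shows "parabolic S M J = cox_elem S M ` lists J"
proof
  have lists: "lists J \<subseteq> lists S" using assms(2) by (rule lists_mono)
  show "parabolic S M J \<subseteq> cox_elem S M ` lists J"
  proof
    fix x assume "x \<in> parabolic S M J"
    then show "x \<in> cox_elem S M ` lists J"
      unfolding parabolic_def
    proof induction
      case one
      then show ?case by (auto simp: one_cox_group)
    next
      case (incl h)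
      then show ?case by auto
    next
      case (inv h)
      then obtain s where s: "s \<in> J" "h = cox_elem S M [s]" by blast
      then have "s \<in> S" using assms(2) by blast
      then have "inv\<^bsub>cox_group S M\<^esub> h = cox_elem S M [s]"
        using inv_cox_generator[of M s S] assms(1) s by simp
      moreover have "[s] \<in> lists J" using s by simp
      ultimately show ?case by blast
    next
      case (eng h1 h2)
      then obtain u v where uv: "u \<in> lists J" "v \<in> lists J" "h1 = cox_elem S M u" "h2 = cox_elem S M v" by blast
      then have "h1 \<otimes>\<^bsub>cox_group S M\<^esub> h2 = cox_elem S M (u @ v)"
        using lists mult_cox_group[of u S v M] by blast
      moreover have "u @ v \<in> lists J" using uv by simp
      ultimately show ?case by blast
    qed
  qed
  show "cox_elem S M ` lists J \<subseteq> parabolic S M J"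
  proof
    fix x assume "x \<in> cox_elem S M ` lists J"
    then obtain u where u: "u \<in> lists J" "x = cox_elem S M u" by blast
    from u(1) have "cox_elem S M u \<in> parabolic S M J"
    proof (induction u)
      case Nil
      then show ?case using generate.one[of "cox_group S M"] by (simp add: parabolic_def one_cox_group)
    next
      case (Cons s u)
      then have "cox_elem S M [s] \<otimes>\<^bsub>cox_group S M\<^esub> cox_elem S M u \<in> parabolic S M J"
        unfolding parabolic_def by (blast intro: generate.eng generate.incl)
      moreover have "s \<in> S" "u \<in> lists S" using Cons.hyps assms(2) lists by blast+
      ultimately show ?case
        using mult_cox_group[of "[s]" S u M] by simp
    qed
    then show "x \<in> parabolic S M J" using u by simp
  qed
qed

lemma cox_length_le: "u \<in> lists S \<Longrightarrow> cox_length S M (cox_elem S M u) \<le> length u"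
  unfolding cox_length_def by (rule Least_le) auto

lemma cox_length_attained:
  assumes "u \<in> lists S"
  obtains v where "v \<in> lists S" "cox_eq S M u v" "length v = cox_length S M (cox_elem S M u)"
proof -
  have "\<exists>k. \<exists>v\<in>lists S. cox_elem S M v = cox_elem S M u \<and> length v = k" using assms by auto
  then have "\<exists>v\<in>lists S. cox_elem S M v = cox_elem S M u \<and> length v = cox_length S M (cox_elem S M u)"
    unfolding cox_length_def by (rule LeastI_ex)
  then show ?thesis using that assms by (metis cox_elem_eq_iff)
qed

section \<open>Shortest words from zero to a given vector\<close>

abbreviation aff_eq :: "nat \<Rightarrow> nat list \<Rightarrow> nat list \<Rightarrow> bool" where
  "aff_eq n \<equiv> cox_eq (aff_gens n) (aff_matrix n)"

abbreviation zvec :: "nat \<Rightarrow> int" where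
  "zvec \<equiv> (\<lambda>_. 0)"

text \<open>Minimality is expressed by the block of the vector that the word reaches:
  \<open>block_len\<close> turns out to be the least length of a word from zero to this
  vector.\<close>

definition min_word :: "nat \<Rightarrow> nat list \<Rightarrow> bool" where
  "min_word n u \<longleftrightarrow> u \<in> lists (aff_gens n) \<and>
     (\<exists>b. sign_block n b \<and> block_vec n b = word_act n u zvec \<and> block_len n b = length u)"

context
  fixes n :: nat
  assumes n: "2 \<le> n"
begin

lemma gens_range: "s \<in> aff_gens n \<longleftrightarrow> 1 \<le> s \<and> s \<le> n + 1"
  by (simp add: aff_gens_def)

text \<open>Each letter changes the block length by one or leaves the vector alone. So all vectors
  in the orbit have blocks, and block lengths bound word lengths from below.\<close>

lemma word_block:
  assumes "u \<in> lists (aff_gens n)"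
  shows "\<exists>b. sign_block n b \<and> block_vec n b = word_act n u zvec \<and> block_len n b \<le> length u"
  using assms
proof (induction u)
  case Nil
  show ?case by (rule exI[of _ "[]"]) simp
next
  case (Cons s u)
  then obtain b where b: "sign_block n b" "block_vec n b = word_act n u zvec" "block_len n b \<le> length u"
    by auto
  have s: "1 \<le> s" "s \<le> n + 1" using Cons gens_range by auto
  consider "0 < gap n s (block_vec n b)" | "gap n s (block_vec n b) < 0" | "gap n s (block_vec n b) = 0"
    by linarith
  then show ?case
  proof cases
    case 1
    then show ?thesis using sign_block_act(1)[OF n b(1) s] b by fastforce
  next
    case 2
    then show ?thesis using sign_block_act(2)[OF n b(1) s] b by fastforce
  next
    case 3
    then show ?thesis using vec_act_gap_0[OF n] b Cons by fastforce
  qed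
qed

lemma block_word_min: "sign_block n b \<Longrightarrow> min_word n (block_word n b)"
  using block_word_lists word_act_block_word length_block_word unfolding min_word_def by metis

lemma min_word_length:
  assumes "sign_block n b" "block_vec n b = word_act n u zvec" "u \<in> lists (aff_gens n)"
  shows "block_len n b \<le> length u" "min_word n u \<longleftrightarrow> length u = block_len n b"
proof -
  obtain b' where "sign_block n b'" "block_vec n b' = word_act n u zvec" "block_len n b' \<le> length u"
    using word_block[OF assms(3)] by blast
  then show "block_len n b \<le> length u" using sign_block_inject[of n b b'] assms by auto
  show "min_word n u \<longleftrightarrow> length u = block_len n b"
    unfolding min_word_def using assms sign_block_inject by metis
qed

lemma gap_act_self: "gap n s (vec_act n s c) = - gap n s c" if "s \<in> aff_gens n"
  using gap_act(1)[OF n that that] .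

text \<open>If \<open>s\<close> did not lengthen the block, the vector of \<open>s # u\<close> would
  have a block of length at most \<open>length u\<close>.\<close>

lemma min_word_Cons:
  assumes "min_word n (s # u)"
  shows "min_word n u" "gap n s (word_act n (s # u) zvec) < 0"
proof -
  have su: "s \<in> aff_gens n" "u \<in> lists (aff_gens n)" "1 \<le> s" "s \<le> n + 1"
    using assms by (auto simp: min_word_def gens_range)
  obtain b where b: "sign_block n b" "block_vec n b = word_act n u zvec" "block_len n b \<le> length u"
    using word_block[OF su(2)] by blast
  obtain d where d: "sign_block n d" "block_vec n d = word_act n (s # u) zvec" "block_len n d = Suc (length u)"
    using assms by (auto simp: min_word_def)
  have act: "block_vec n d = vec_act n s (block_vec n b)" using b d by simp
  have "gap n s (block_vec n b) > 0"
  proof (rule ccontr)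
    assume "\<not> gap n s (block_vec n b) > 0"
    then consider "gap n s (block_vec n b) < 0" | "gap n s (block_vec n b) = 0" by linarith
    then show False
    proof cases
      case 1
      then show False using sign_block_act(2)[OF n b(1) su(3,4) 1] act d b sign_block_inject by fastforce
    next
      case 2
      then show False using vec_act_gap_0[OF n su(1) 2] act d b sign_block_inject by fastforce
    qed
  qed
  then have "block_len n d = block_len n b + 1"
    using sign_block_act(1)[OF n b(1) su(3,4)] act d sign_block_inject by metis
  then show "min_word n u" using min_word_length(2)[OF b(1,2) su(2)] d by simp
  show "gap n s (word_act n (s # u) zvec) < 0"
    using \<open>gap n s (block_vec n b) > 0\<close> b gap_act_self[OF su(1)] by simp
qed

lemma descend:
  assumes "sign_block n b" "s \<in> aff_gens n" "gap n s (block_vec n b) < 0"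
  obtains b' where "sign_block n b'" "block_vec n b' = vec_act n s (block_vec n b)" "block_len n b = block_len n b' + 1"
  using sign_block_act(2)[OF n assms(1)] assms gens_range by blast

lemma min_word_extend:
  assumes "sign_block n b" "sign_block n b'" "block_vec n b' = vec_act n s (block_vec n b)"
    "block_len n b = block_len n b' + 1" "s \<in> aff_gens n" "min_word n x" "word_act n x zvec = block_vec n b'"
  shows "min_word n (s # x)" "word_act n (s # x) zvec = block_vec n b"
proof -
  have "vec_act n s (vec_act n s (block_vec n b)) = block_vec n b" using n by (simp add: vec_act_vec_act)
  then show act: "word_act n (s # x) zvec = block_vec n b" using assms by simp
  have "x \<in> lists (aff_gens n)" using assms by (simp add: min_word_def)
  then show "min_word n (s # x)"
    using min_word_length(2)[OF assms(1), of "s # x"] min_word_length(2)[OF assms(2), of x] act assms by simp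
qed

text \<open>Matsumoto's argument. If the first letters \<open>s\<close> and \<open>t\<close> differ,
  both shorten the block, and one descends with them alternately to a common vector. The shortest
  words through it are equivalent to \<open>u\<close> and \<open>v\<close> by induction, and to each
  other by the relation between \<open>s\<close> and \<open>t\<close>.\<close>

lemma min_word_unique:
  assumes "min_word n u" "min_word n v" "word_act n u zvec = word_act n v zvec"
  shows "aff_eq n u v"
  using assms
proof (induction "length u" arbitrary: u v rule: less_induct)
  case less
  obtain b where b: "sign_block n b" "block_vec n b = word_act n u zvec" "block_len n b = length u"
    using less.prems by (auto simp: min_word_def)
  have lists: "u \<in> lists (aff_gens n)" "v \<in> lists (aff_gens n)" using less.prems by (auto simp: min_word_def)
  have len: "length v = length u" using min_word_length(2)[OF b(1), of v] b less.prems lists by simp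
  show ?case
  proof (cases u)
    case Nil
    then show ?thesis using len cox_eq.refl[of "[]"] by simp
  next
    case u: (Cons s u1)
    then obtain t v1 where v: "v = t # v1" using len by (cases v) auto
    have st: "s \<in> aff_gens n" "t \<in> aff_gens n" using lists u v by auto
    have min1: "min_word n u1" "min_word n v1" and gaps: "gap n s (block_vec n b) < 0" "gap n t (block_vec n b) < 0"
      using min_word_Cons[of s u1] min_word_Cons[of t v1] less.prems u v b by auto
    have inv: "vec_act n r (vec_act n r c) = c" for r c using n by (simp add: vec_act_vec_act)
    have u1: "word_act n u1 zvec = vec_act n s (block_vec n b)" using b u inv by simp
    have v1: "word_act n v1 zvec = vec_act n t (block_vec n b)" using b less.prems(3) v inv by simp
    have IHu: "aff_eq n u1 w" if "min_word n w" "word_act n w zvec = vec_act n s (block_vec n b)" for w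
      using less.hyps[of u1 w] that min1 u1 u by simp
    have IHv: "aff_eq n v1 w" if "min_word n w" "word_act n w zvec = vec_act n t (block_vec n b)" for w
      using less.hyps[of v1 w] that min1 v1 v len u by simp
    have reduce: "aff_eq n u v" if "aff_eq n u1 w" "aff_eq n v1 w'" "aff_eq n (s # w) (t # w')" for w w'
      using cox_eq_Cons[OF that(1) st(1)] cox_eq_Cons[OF that(2) st(2)] that(3) u v
      by (meson cox_eq.sym cox_eq.trans)
    obtain bs where bs: "sign_block n bs" "block_vec n bs = vec_act n s (block_vec n b)" "block_len n b = block_len n bs + 1"
      using descend[OF b(1) st(1) gaps(1)] .
    obtain bt where bt: "sign_block n bt" "block_vec n bt = vec_act n t (block_vec n b)" "block_len n b = block_len n bt + 1"
      using descend[OF b(1) st(2) gaps(2)] .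
    consider "s = t" | "s \<noteq> t" "\<not> aff_adjacent n s t" | "s \<noteq> t" "aff_adjacent n s t" by blast
    then show ?thesis
    proof cases
      case 1
      then have "aff_eq n u1 v1" using IHu[OF min1(2)] v1 by simp
      then show ?thesis using cox_eq_Cons st u v 1 by metis
    next
      case 2
      have nadj: "\<not> aff_adjacent n t s" using 2 aff_adjacent_sym by blast
      have "gap n t (block_vec n bs) < 0" using gap_act(3)[OF n st 2] gaps bs by simp
      then obtain d where d: "sign_block n d" "block_vec n d = vec_act n t (block_vec n bs)" "block_len n bs = block_len n d + 1"
        using descend[OF bs(1) st(2)] by metis
      have d': "block_vec n d = vec_act n s (block_vec n bt)" "block_len n bt = block_len n d + 1"
        using d bs bt vec_act_commute[OF n st 2] by auto
      define x where "x = block_word n d"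
      have x: "min_word n x" "word_act n x zvec = block_vec n d" "x \<in> lists (aff_gens n)"
        using d block_word_min word_act_block_word block_word_lists by (auto simp: x_def)
      note tx = min_word_extend[OF bs(1) d(1,2,3) st(2) x(1,2)]
      note sx = min_word_extend[OF bt(1) d(1) d' st(1) x(1,2)]
      have "aff_eq n (s # t # x) (t # s # x)"
        using 2 st x by (intro cox_eq_commute) (auto simp: aff_matrix_def)
      then show ?thesis using reduce[OF IHu IHv] tx sx bs bt by metis
    next
      case 3
      have adj: "aff_adjacent n t s" using 3 aff_adjacent_sym by blast
      have "gap n t (block_vec n bs) < 0" using gap_act(2)[OF n st 3(2)] gaps bs by simp
      then obtain d where d: "sign_block n d" "block_vec n d = vec_act n t (block_vec n bs)" "block_len n bs = block_len n d + 1"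
        using descend[OF bs(1) st(2)] by metis
      \<comment> \<open>The three gaps met on the way down are, in terms of values at
        \<open>block_vec n b\<close>, that of \<open>s\<close>, the sum of both, and that of
        \<open>t\<close>; all are negative.\<close>
      have "gap n s (block_vec n d) < 0"
        using gap_act(2)[OF n st(2,1) adj] gap_act(2)[OF n st 3(2)] gap_act_self[OF st(1)] gaps d bs by simp
      then obtain e where e: "sign_block n e" "block_vec n e = vec_act n s (block_vec n d)" "block_len n d = block_len n e + 1"
        using descend[OF d(1) st(1)] by metis
      have "gap n s (block_vec n bt) < 0" using gap_act(2)[OF n st(2,1) adj] gaps bt by simp
      then obtain d' where d': "sign_block n d'" "block_vec n d' = vec_act n s (block_vec n bt)" "block_len n bt = block_len n d' + 1"
        using descend[OF bt(1) st(1)] by metis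
      \<comment> \<open>The braid relation on vectors makes the descent that starts with
        \<open>t\<close> end at the same vector.\<close>
      have e': "block_vec n e = vec_act n t (block_vec n d')" "block_len n d' = block_len n e + 1"
        using e d d' bs bt vec_act_braid[OF n st 3(2)] by auto
      define x where "x = block_word n e"
      have x: "min_word n x" "word_act n x zvec = block_vec n e" "x \<in> lists (aff_gens n)"
        using e block_word_min word_act_block_word block_word_lists by (auto simp: x_def)
      note sx = min_word_extend[OF d(1) e(1,2,3) st(1) x(1,2)]
      note tsx = min_word_extend[OF bs(1) d(1,2,3) st(2) sx]
      note tx = min_word_extend[OF d'(1) e(1) e' st(2) x(1,2)]
      note stx = min_word_extend[OF bt(1) d'(1,2,3) st(1) tx]
      have "aff_eq n (s # t # s # x) (t # s # t # x)"
        using 3 st x by (intro cox_eq_braid) (auto simp: aff_matrix_def)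
      then show ?thesis using reduce[OF IHu IHv] tsx stx bs bt by metis
    qed
  qed
qed

text \<open>Deodhar's lemma for vectors. The letter \<open>s\<close> slides past a commuting first
  letter \<open>t\<close>. If \<open>s\<close> and \<open>t\<close> are joined, the word is
  equivalent to some \<open>t s y\<close>; the braid relation turns \<open>s t s y\<close> into
  \<open>t s t y\<close>, where \<open>t\<close> fixes the vector of \<open>y\<close>, and induction
  applies to \<open>y\<close>.\<close>

lemma min_word_fixed:
  assumes "min_word n x" "s \<in> aff_gens n" "gap n s (word_act n x zvec) = 0"
  shows "\<exists>v. 1 \<le> v \<and> v \<le> n \<and> aff_eq n (s # x) (x @ [v])"
  using assms
proof (induction "length x" arbitrary: x s rule: less_induct)
  case less
  show ?case
  proof (cases x)
    case Nil
    \<comment> \<open>At zero the gap of \<open>n + 1\<close> is 1, which excludes this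
      generator.\<close>
    then have "s \<le> n" "1 \<le> s" using less.prems gens_range by (auto simp: gap_def le_Suc_eq)
    then show ?thesis using Nil less.prems cox_eq.refl[of "[s]"] by (intro exI[of _ s]) simp
  next
    case x: (Cons t x1)
    have xl: "x \<in> lists (aff_gens n)" using less.prems by (simp add: min_word_def)
    have st: "s \<in> aff_gens n" "t \<in> aff_gens n" and x1l: "x1 \<in> lists (aff_gens n)" using xl x less.prems by auto
    define c where "c = word_act n x zvec"
    have min1: "min_word n x1" and gapt: "gap n t c < 0"
      using min_word_Cons[of t x1] less.prems x by (auto simp: c_def)
    have inv: "vec_act n r (vec_act n r c) = c" for r c using n by (simp add: vec_act_vec_act)
    have x1: "word_act n x1 zvec = vec_act n t c" using x inv by (simp add: c_def)
    have gaps: "gap n s c = 0" using less.prems by (simp add: c_def)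
    then have "s \<noteq> t" using gapt by auto
    then consider "\<not> aff_adjacent n s t" "\<not> aff_adjacent n t s" | "aff_adjacent n s t" "aff_adjacent n t s"
      using aff_adjacent_sym by blast
    then show ?thesis
    proof cases
      case 1
      have "gap n s (word_act n x1 zvec) = 0"
        using gap_act(3)[OF n st(2,1) \<open>s \<noteq> t\<close>[symmetric] 1(2)] gaps x1 by simp
      then obtain v where v: "1 \<le> v" "v \<le> n" "aff_eq n (s # x1) (x1 @ [v])"
        using less.hyps[of x1 s] x min1 st by auto
      have "aff_eq n (s # t # x1) (t # s # x1)"
        using 1 \<open>s \<noteq> t\<close> st x1l by (intro cox_eq_commute) (auto simp: aff_matrix_def)
      moreover have "aff_eq n (t # s # x1) (t # x1 @ [v])" using cox_eq_Cons[OF v(3) st(2)] .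
      ultimately show ?thesis using v x cox_eq.trans by (metis append_Cons)
    next
      case 2
      obtain b where b: "sign_block n b" "block_vec n b = c" "block_len n b = length x"
        using less.prems by (auto simp: min_word_def c_def)
      obtain bt where bt: "sign_block n bt" "block_vec n bt = vec_act n t (block_vec n b)" "block_len n b = block_len n bt + 1"
        using descend[OF b(1) st(2)] gapt b by metis
      have "gap n s (block_vec n bt) < 0" using gap_act(2)[OF n st(2,1) 2(2)] gaps gapt bt b by simp
      then obtain d where d: "sign_block n d" "block_vec n d = vec_act n s (block_vec n bt)" "block_len n bt = block_len n d + 1"
        using descend[OF bt(1) st(1)] by metis
      \<comment> \<open>As \<open>gap n s c = 0\<close>, the two contributions are
        \<open>- gap n t c\<close> and \<open>gap n t c\<close>.\<close>
      have gd: "gap n t (block_vec n d) = 0"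
        using gap_act(2)[OF n st 2(1)] gap_act(2)[OF n st(2,1) 2(2)] gap_act_self[OF st(2)] gaps gapt bt d b by simp
      define y where "y = block_word n d"
      have y: "min_word n y" "word_act n y zvec = block_vec n d" "y \<in> lists (aff_gens n)" "length y = block_len n d"
        using d block_word_min word_act_block_word block_word_lists length_block_word by (auto simp: y_def)
      note sy = min_word_extend[OF bt(1) d(1,2,3) st(1) y(1,2)]
      note tsy = min_word_extend[OF b(1) bt(1,2,3) st(2) sy]
      have eq: "aff_eq n x (t # s # y)"
        using min_word_unique[OF less.prems(1) tsy(1)] tsy(2) b c_def by simp
      obtain v where v: "1 \<le> v" "v \<le> n" "aff_eq n (t # y) (y @ [v])"
        using less.hyps[of y t] y st gd d bt b by auto
      have vS: "v \<in> aff_gens n" using v gens_range by auto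
      have "aff_eq n (s # x) (s # t # s # y)" using cox_eq_Cons[OF eq st(1)] .
      moreover have "aff_eq n (s # t # s # y) (t # s # t # y)"
        using 2 \<open>s \<noteq> t\<close> st y by (intro cox_eq_braid) (auto simp: aff_matrix_def)
      moreover have "aff_eq n (t # s # t # y) (t # s # y @ [v])" using cox_eq_Cons[OF cox_eq_Cons[OF v(3)]] st by simp
      moreover have "aff_eq n (t # s # y @ [v]) (x @ [v])"
        using cox_eq_append[OF cox_eq.sym[OF eq], of "[v]"] vS by simp
      ultimately show ?thesis using v cox_eq.trans by metis
    qed
  qed
qed

end

section \<open>Distinguished representatives and extremal elements\<close>

context
  fixes n :: nat
  assumes n: "2 \<le> n"
begin

section \<open>Distinguished representatives\<close>

lemma fin_lists: "lists {1..n} \<subseteq> lists (aff_gens n)"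
  by (rule lists_mono) (auto simp: aff_gens_def)

lemma fin_subgroup_conv: "fin_subgroup n = aff_elem n ` lists {1..n}"
  by (rule parabolic_conv) (auto simp: aff_matrix_def aff_gens_def)

lemma word_act_fin: "z \<in> lists {1..n} \<Longrightarrow> word_act n z zvec = zvec"
  by (induction z) (auto simp: vec_act_def)

lemma aff_length_min_word:
  assumes "min_word n x"
  shows "aff_length n (aff_elem n x) = length x"
proof (rule antisym)
  have x: "x \<in> lists (aff_gens n)" using assms by (simp add: min_word_def)
  show "aff_length n (aff_elem n x) \<le> length x" by (rule cox_length_le[OF x])
  obtain v where v: "v \<in> lists (aff_gens n)" "aff_eq n x v"
      "length v = aff_length n (aff_elem n x)"
    using cox_length_attained[OF x] .
  obtain b where b: "sign_block n b" "block_vec n b = word_act n x zvec" "block_len n b = length x"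
    using assms by (auto simp: min_word_def)
  have "block_len n b \<le> length v"
    using min_word_length(1)[OF n b(1) _ v(1)] b word_act_cox_eq[OF n v(2)] by simp
  then show "length x \<le> aff_length n (aff_elem n x)" using b v by simp
qed

text \<open>Words in the generators \<open>1..n\<close> fix zero, so all words for elements of the
  coset lead to the same vector and are at least as long as \<open>x\<close>. One of equal length is
  again shortest and thus expresses the same element.\<close>

lemma min_word_distinguished:
  assumes "min_word n x"
  shows "aff_distinguished n (aff_elem n x)"
  unfolding distinguished_rep_def
proof (intro conjI ballI impI)
  have x: "x \<in> lists (aff_gens n)" using assms by (simp add: min_word_def)
  then show "aff_elem n x \<in> carrier (aff_group n)" by (simp add: carrier_cox_group)
  fix y assume "y \<in> aff_elem n x <#\<^bsub>aff_group n\<^esub> fin_subgroup n" and neq: "y \<noteq> aff_elem n x"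
  then obtain z where z: "z \<in> lists {1..n}" "y = aff_elem n x \<otimes>\<^bsub>aff_group n\<^esub> aff_elem n z"
    unfolding l_coset_def fin_subgroup_conv by blast
  then have zl: "z \<in> lists (aff_gens n)" using fin_lists by blast
  have y: "y = aff_elem n (x @ z)" using z mult_cox_group[OF x zl] by simp
  have xz: "x @ z \<in> lists (aff_gens n)" using x zl by simp
  obtain v where v: "v \<in> lists (aff_gens n)" "aff_eq n (x @ z) v"
      "length v = aff_length n y"
    using cox_length_attained[OF xz, of "aff_matrix n"] y by metis
  have act: "word_act n v zvec = word_act n x zvec"
    using word_act_cox_eq[OF n v(2), of zvec] word_act_fin[OF z(1)] by simp
  obtain b where b: "sign_block n b" "block_vec n b = word_act n x zvec" "block_len n b = length x"
    using assms by (auto simp: min_word_def)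
  have le: "length x \<le> length v" using min_word_length(1)[OF n b(1) _ v(1)] b act by simp
  have "length x \<noteq> length v"
  proof
    assume "length x = length v"
    then have "min_word n v" using min_word_length(2)[OF n b(1) _ v(1)] b act by simp
    then have "aff_eq n x v" using min_word_unique[OF n assms] act by simp
    then have "aff_eq n (x @ z) x" using v(2) by (meson cox_eq.sym cox_eq.trans)
    then show False using neq y cox_elem_eq_iff[OF xz] by simp
  qed
  then show "aff_length n (aff_elem n x) < aff_length n y"
    using le v aff_length_min_word[OF assms] by simp
qed

text \<open>The zero vector does not detect \<open>v\<close>; the indicator vector of position
  \<open>v\<close> does, since the action of \<open>x\<close> is undone by
  \<open>rev x\<close>.\<close>

lemma generator_nontrivial:
  assumes "x \<in> lists (aff_gens n)" "1 \<le> v" "v \<le> n"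
  shows "aff_elem n (x @ [v]) \<noteq> aff_elem n x"
proof
  assume eq: "aff_elem n (x @ [v]) = aff_elem n x"
  have vl: "x @ [v] \<in> lists (aff_gens n)" using assms by (auto simp: aff_gens_def)
  have E: "aff_eq n (x @ [v]) x" using eq cox_elem_eq_iff[OF vl] by simp
  have inv: "word_act n (rev x) (word_act n x d) = d" for d
    using n by (induction x arbitrary: d) (simp_all add: vec_act_vec_act)
  define d :: "nat \<Rightarrow> int" where "d = (\<lambda>y. if y = v then 1 else 0)"
  have "word_act n x (vec_act n v d) = word_act n x d" using word_act_cox_eq[OF n E, of d] by simp
  then have "vec_act n v d = d" using inv by metis
  then have "vec_act n v d v = d v" by simp
  then show False using assms by (simp add: vec_act_def d_def)
qed

text \<open>The element of \<open>x @ [v]\<close> lies in the coset of the distinguished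
  \<open>x\<close> without being equal to it, so it is strictly longer, and by no more than one
  letter.\<close>

lemma not_distinguished_fixed:
  assumes "min_word n x" "s \<in> aff_gens n" "gap n s (word_act n x zvec) = 0"
  shows "\<not> aff_distinguished n (aff_elem n (s # x)) \<and>
    aff_length n (aff_elem n (s # x)) = aff_length n (aff_elem n x) + 1 \<and>
    (\<exists>v. 1 \<le> v \<and> v \<le> n \<and> aff_elem n (s # x) = aff_elem n x \<otimes>\<^bsub>aff_group n\<^esub> aff_elem n [v])"
proof -
  have x: "x \<in> lists (aff_gens n)" using assms by (simp add: min_word_def)
  obtain v where v: "1 \<le> v" "v \<le> n" "aff_eq n (s # x) (x @ [v])"
    using min_word_fixed[OF n assms] by blast
  have vl: "[v] \<in> lists (aff_gens n)" "[v] \<in> lists {1..n}" using v by (auto simp: aff_gens_def)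
  have sx: "s # x \<in> lists (aff_gens n)" using x assms by simp
  have eq: "aff_elem n (s # x) = aff_elem n (x @ [v])" using v(3) cox_elem_eq_iff[OF sx] by simp
  have neq: "aff_elem n (x @ [v]) \<noteq> aff_elem n x" using generator_nontrivial[OF x v(1,2)] .
  have mult: "aff_elem n (x @ [v]) = aff_elem n x \<otimes>\<^bsub>aff_group n\<^esub> aff_elem n [v]"
    using mult_cox_group[OF x vl(1)] by simp
  have V: "aff_elem n [v] \<in> fin_subgroup n" using vl fin_subgroup_conv by blast
  have "aff_elem n (x @ [v]) \<in> aff_elem n x <#\<^bsub>aff_group n\<^esub> fin_subgroup n"
    using mult V unfolding l_coset_def by blast
  then have less: "aff_length n (aff_elem n x) < aff_length n (aff_elem n (x @ [v]))"
    using min_word_distinguished[OF assms(1)] neq unfolding distinguished_rep_def by blast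
  have "aff_eq n (x @ [v, v]) (x @ [])"
    using cox_eq_cong[OF cox_eq_square[of "aff_matrix n" v "aff_gens n" "[]"], of x "[]"] vl x
    by (simp add: aff_matrix_def)
  then have "aff_elem n x = aff_elem n (x @ [v]) \<otimes>\<^bsub>aff_group n\<^esub> aff_elem n [v]"
    using mult_cox_group[of "x @ [v]" "aff_gens n" "[v]" "aff_matrix n"] vl x
      cox_elem_eq_iff[of "x @ [v, v]" "aff_gens n" "aff_matrix n" x]
    by simp
  then have "aff_elem n x \<in> aff_elem n (x @ [v]) <#\<^bsub>aff_group n\<^esub> fin_subgroup n"
    using V unfolding l_coset_def by blast
  then have "\<not> aff_distinguished n (aff_elem n (x @ [v]))"
    using less neq unfolding distinguished_rep_def by fastforce
  moreover have "aff_length n (aff_elem n (s # x)) \<le> length x + 1" using cox_length_le[OF sx] by simp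
  ultimately show ?thesis
    using less aff_length_min_word[OF assms(1)] eq mult v(1,2) by (metis Suc_eq_plus1 Suc_leI le_antisym)
qed

text \<open>If the length rises, both words are shortest for the same vector. If it falls,
  uniqueness is applied to the word of \<open>b\<close> and \<open>s\<close> followed by the word of
  \<open>b'\<close>, and the square of \<open>s\<close> cancels.\<close>

lemma elem_act_block:
  assumes "sign_block n b" "sign_block n b'" "s \<in> aff_gens n" "block_vec n b' = vec_act n s (block_vec n b)"
    and "block_len n b' = block_len n b + 1 \<or> block_len n b = block_len n b' + 1"
  shows "aff_elem n (s # block_word n b) = aff_elem n (block_word n b')"
proof -
  define x y where "x = block_word n b" and "y = block_word n b'"
  have x: "min_word n x" "word_act n x zvec = block_vec n b" "x \<in> lists (aff_gens n)"
    and y: "min_word n y" "word_act n y zvec = block_vec n b'" "y \<in> lists (aff_gens n)"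
    using assms block_word_min[OF n] word_act_block_word block_word_lists by (auto simp: x_def y_def)
  have sx: "s # x \<in> lists (aff_gens n)" using x assms by simp
  have b_act: "block_vec n b = vec_act n s (block_vec n b')" using n assms(4) by (simp add: vec_act_vec_act)
  have "aff_eq n (s # x) y"
    using assms(5)
  proof
    assume "block_len n b' = block_len n b + 1"
    note sx = min_word_extend[OF n assms(2,1) b_act this assms(3) x(1,2)]
    show ?thesis using min_word_unique[OF n sx(1) y(1)] sx(2) y(2) by simp
  next
    assume "block_len n b = block_len n b' + 1"
    note sy = min_word_extend[OF n assms(1,2,4) this assms(3) y(1,2)]
    have "aff_eq n x (s # y)"
      using min_word_unique[OF n x(1) sy(1)] sy(2) x(2) by simp
    then have "aff_eq n (s # x) (s # s # y)"
      using assms(3) by (rule cox_eq_Cons)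
    moreover have "aff_eq n (s # s # y) y"
      using assms(3) y(3) by (intro cox_eq_square) (simp_all add: aff_matrix_def)
    ultimately show ?thesis by (rule cox_eq.trans)
  qed
  then show ?thesis using cox_elem_eq_iff[OF sx] by (simp add: x_def y_def)
qed

section \<open>Triviality, length and extremality of the elements \<open>h\<close>\<close>

lemma word_act_h_word:
  assumes "1 \<le> j" "j \<le> n + 1" "i + 1 \<le> n"
  shows "word_act n (h_word n j i) c (pos j i) = c 1" "word_act n (h_word n j i) c j = c (n + 1)"
  using assms word_act_down[of i n c] by (auto simp: h_word_def word_act_up pos_def)

lemma h_word_fin: "1 \<le> j \<Longrightarrow> i + 1 \<le> n \<Longrightarrow> h_word n j i \<in> lists {1..n}"
  using set_h_word[of j i n] by auto

lemma h_word_trivial_iff: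
  assumes "1 \<le> j" "j \<le> n + 1" "i + 1 \<le> n"
  shows "aff_elem n (h_word n j i) = \<one>\<^bsub>aff_group n\<^esub> \<longleftrightarrow> pos j i = 1 \<and> j = n + 1"
proof
  have hl: "h_word n j i \<in> lists (aff_gens n)" using h_word_fin assms fin_lists by blast
  assume "aff_elem n (h_word n j i) = \<one>\<^bsub>aff_group n\<^esub>"
  then have "aff_eq n (h_word n j i) []"
    using cox_elem_eq_iff[OF hl] by (simp add: one_cox_group)
  \<comment> \<open>\<open>int\<close> is a vector with distinct entries, so its image shows where
    positions 1 and \<open>n + 1\<close> are sent.\<close>
  then have "word_act n (h_word n j i) int = int" using word_act_cox_eq[OF n] by fastforce
  then show "pos j i = 1 \<and> j = n + 1" using word_act_h_word[OF assms, of int] by simp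
next
  assume "pos j i = 1 \<and> j = n + 1"
  then have "j = n + 1" "i = 0" using n by (auto simp: pos_def split: if_splits)
  then show "aff_elem n (h_word n j i) = \<one>\<^bsub>aff_group n\<^esub>"
    by (simp add: one_cox_group h_word_def up_word_def down_word_def)
qed

lemma sign_block_singleton: "1 \<le> j \<Longrightarrow> j \<le> n + 1 \<Longrightarrow> i + 1 \<le> n \<Longrightarrow> sign_block n [(j, i)]"
  using affine_block_iff_sign_block[OF n, of "[(j, i)]"] affine_block_singleton[of n j i] by auto

text \<open>A shorter expression of \<open>h\<close>, followed by the letter \<open>n + 1\<close>,
  would be shorter than the block word of \<open>[(j, i)]\<close>, which is shortest for its
  vector.\<close>

lemma aff_length_h_word:
  assumes "1 \<le> j" "j \<le> n + 1" "i + 1 \<le> n"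
  shows "aff_length n (aff_elem n (h_word n j i)) = length (h_word n j i)"
proof (rule antisym)
  have hl: "h_word n j i \<in> lists (aff_gens n)" using h_word_fin assms fin_lists by blast
  show "aff_length n (aff_elem n (h_word n j i)) \<le> length (h_word n j i)" by (rule cox_length_le[OF hl])
  obtain v where v: "v \<in> lists (aff_gens n)" "aff_eq n (h_word n j i) v"
      "length v = aff_length n (aff_elem n (h_word n j i))"
    using cox_length_attained[OF hl] .
  have a: "[n + 1] \<in> lists (aff_gens n)" by (simp add: aff_gens_def)
  have Bw: "block_word n [(j, i)] = h_word n j i @ [n + 1]" by (simp add: block_word_def B_word_def)
  have sb: "sign_block n [(j, i)]" by (rule sign_block_singleton[OF assms])
  have "aff_eq n (block_word n [(j, i)]) (v @ [n + 1])"
    unfolding Bw by (rule cox_eq_append[OF v(2) a])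
  then have "block_vec n [(j, i)] = word_act n (v @ [n + 1]) zvec"
    using word_act_cox_eq[OF n] word_act_block_word[OF sb] by metis
  then have "block_len n [(j, i)] \<le> length (v @ [n + 1])"
    using v a by (intro min_word_length(1)[OF n sb]) auto
  then show "length (h_word n j i) \<le> aff_length n (aff_elem n (h_word n j i))"
    using v length_block_word[OF sb] Bw by simp
qed

text \<open>The vector equal to \<open>1\<close> on \<open>{1..k}\<close> and \<open>0\<close> beyond is moved by the generator \<open>k\<close> only.\<close>

lemma letter_needed:
  assumes "aff_eq n u w" "k \<notin> set u"
  defines "d \<equiv> (\<lambda>x. if x \<le> k then 1 else 0 :: int)"
  assumes "1 \<le> k" "k \<le> n"
  shows "word_act n w d = d"
proof -
  have fixed: "vec_act n t d = d" if "t \<in> aff_gens n" "t \<noteq> k" for t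
  proof (rule vec_act_gap_0[OF n that(1)])
    show "gap n t d = 0" using that assms(4,5) by (auto simp: gap_def d_def aff_gens_def)
  qed
  have "u \<in> lists (aff_gens n)" using cox_eq_lists[OF assms(1)] by simp
  then have "word_act n u d = d" using assms(2) by (induction u) (auto simp: fixed)
  then show ?thesis using word_act_cox_eq[OF n assms(1)] by metis
qed

text \<open>If one of the two runs in \<open>h\<close> is empty, \<open>letter_needed\<close> forces
  all letters of the other run into every reduced expression. The length then leaves no room for the
  missing letter 1 or \<open>n\<close>.\<close>

lemma extremal_h_word_iff:
  assumes "1 \<le> j" "j \<le> n + 1" "i + 1 \<le> n"
  shows "extremal n (aff_elem n (h_word n j i)) \<longleftrightarrow> pos j i \<noteq> 1 \<and> j \<noteq> n + 1"
proof
  have hl: "h_word n j i \<in> lists (aff_gens n)" using h_word_fin assms fin_lists by blast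
  assume "extremal n (aff_elem n (h_word n j i))"
  then obtain u where u: "u \<in> lists (aff_gens n)" "aff_elem n u = aff_elem n (h_word n j i)"
      "length u = aff_length n (aff_elem n (h_word n j i))" "1 \<in> set u" "n \<in> set u"
    by (auto simp: extremal_def reduced_expression_def)
  have E: "aff_eq n u (h_word n j i)" using u(2) cox_elem_eq_iff[OF u(1)] by simp
  have len: "card (set u) \<le> (n + 1 - j) + i"
    using card_length[of u] u aff_length_h_word[OF assms] length_h_word[of j n i] assms by simp
  have ind: "k \<in> set u" if "1 \<le> k" "k \<le> n"
      "word_act n (h_word n j i) (\<lambda>x. if x \<le> k then 1 else 0) y \<noteq> (if y \<le> k then 1 else 0)" for k y
  proof (rule ccontr)
    assume "k \<notin> set u"
    from fun_cong[OF letter_needed[OF E this that(1,2)], of y] show False using that(3) by simp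
  qed
  show "pos j i \<noteq> 1 \<and> j \<noteq> n + 1"
  proof (intro conjI notI)
    assume p: "pos j i = 1"
    then have i: "i = 0" "1 < j" by (auto simp: pos_def split: if_splits)
    have "{j..n} \<subseteq> set u"
    proof
      fix k assume k: "k \<in> {j..n}"
      have "word_act n (h_word n j i) (\<lambda>x. if x \<le> k then 1 else 0) j \<noteq> (if j \<le> k then 1 else 0)"
        using word_act_h_word(2)[OF assms, of "\<lambda>x. if x \<le> k then 1 else 0"] k by simp
      then show "k \<in> set u" using k assms by (intro ind) auto
    qed
    \<comment> \<open>As \<open>1 < j\<close>, this set has one element more than the length
      \<open>n + 1 - j\<close> allows.\<close>
    then have "card (insert 1 {j..n}) \<le> card (set u)" using u by (intro card_mono) auto
    then show False using len i assms by simp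
  next
    assume j: "j = n + 1"
    then have p: "pos j i = i + 1" using assms by (simp add: pos_def)
    have "{1..i} \<subseteq> set u"
    proof
      fix k assume k: "k \<in> {1..i}"
      have "word_act n (h_word n j i) (\<lambda>x. if x \<le> k then 1 else 0) (i + 1) \<noteq> (if i + 1 \<le> k then 1 else 0)"
        using word_act_h_word(1)[OF assms, of "\<lambda>x. if x \<le> k then 1 else 0"] k p by simp
      then show "k \<in> set u" using k assms by (intro ind) auto
    qed
    then have "card (insert n {1..i}) \<le> card (set u)" using u by (intro card_mono) auto
    then show False using len j assms by simp
  qed
next
  assume *: "pos j i \<noteq> 1 \<and> j \<noteq> n + 1"
  have hl: "h_word n j i \<in> lists (aff_gens n)" using h_word_fin assms fin_lists by blast
  \<comment> \<open>The letter 1 comes from the descending run if \<open>i > 0\<close>; otherwise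
    \<open>pos j i \<noteq> 1\<close> forces \<open>j = 1\<close>, and it starts the ascending
    run.\<close>
  have "1 \<in> set (h_word n j i)" "n \<in> set (h_word n j i)"
    using * assms n by (auto simp: h_word_def up_word_def down_word_def pos_def split: if_splits)
  moreover have "aff_elem n (h_word n j i) \<in> fin_subgroup n"
    using h_word_fin assms fin_subgroup_conv by blast
  ultimately show "extremal n (aff_elem n (h_word n j i))"
    using hl aff_length_h_word[OF assms] unfolding extremal_def reduced_expression_def by metis
qed

end

theorem theorem5p1:
  fixes n s :: nat and b :: "(nat \<times> nat) list" and w\<^sub>a sw\<^sub>a :: "nat list set"
  assumes "n \<ge> 2"
    and "affine_block n b"
    and "length b \<ge> 1"
    and "w\<^sub>a = aff_elem n (block_word n b)"
    and "s \<in> aff_gens n"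
    and "sw\<^sub>a = aff_elem n [s] \<otimes>\<^bsub>aff_group n\<^esub> w\<^sub>a"
  shows
    "(\<not> aff_distinguished n sw\<^sub>a \<and>
      aff_length n sw\<^sub>a = aff_length n w\<^sub>a + 1 \<and>
      (\<exists>v. 1 \<le> v \<and> v \<le> n \<and> sw\<^sub>a = w\<^sub>a \<otimes>\<^bsub>aff_group n\<^esub> aff_elem n [v]))
   \<or> (aff_distinguished n sw\<^sub>a \<and>
      (let h\<^sub>1 = aff_elem n (h_word n (jj b 1) (ii b 1));
           case_a = (s = n + 1 \<and> h\<^sub>1 = \<one>\<^bsub>aff_group n\<^esub>);
           case_b = (s = n + 1 \<and> extremal n h\<^sub>1)
       in (case_a \<and>
           affine_block n (tl b) \<and> sw\<^sub>a = aff_elem n (block_word n (tl b)))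
        \<or> (case_b \<and>
           affine_block n ((n + 1, 0) # b) \<and> sw\<^sub>a = aff_elem n (block_word n ((n + 1, 0) # b)))
        \<or> (\<not> case_a \<and> \<not> case_b \<and>
           (\<exists>b' r. affine_block n b' \<and> length b' = length b \<and>
              sw\<^sub>a = aff_elem n (block_word n b') \<and>
              differ_at b b' r \<and>
              (aff_length n sw\<^sub>a = aff_length n w\<^sub>a + 1 \<longrightarrow>
                 jj b' r + 1 = jj b r \<or> ii b' r = ii b r + 1) \<and>
              (aff_length n sw\<^sub>a + 1 = aff_length n w\<^sub>a \<longrightarrow>
                 jj b' r = jj b r + 1 \<or> ii b' r + 1 = ii b r)))))"
proof -
  note n = assms(1)
  obtain j i t where b: "b = (j, i) # t" using assms(3) by (cases b) auto
  have sb: "sign_block n b" using assms(2) affine_block_iff_sign_block[OF n] by simp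
  have rng: "1 \<le> j" "j \<le> n + 1" "i + 1 \<le> n" using sb b by auto
  have s: "1 \<le> s" "s \<le> n + 1" using assms(5) by (auto simp: aff_gens_def)
  define x c where "x = block_word n b" and "c = block_vec n b"
  have x: "min_word n x" "word_act n x zvec = c" "x \<in> lists (aff_gens n)"
    using block_word_min[OF n sb] word_act_block_word[OF sb] block_word_lists[OF sb] by (simp_all add: x_def c_def)
  have w: "w\<^sub>a = aff_elem n x" using assms(4) by (simp add: x_def)
  have sw: "sw\<^sub>a = aff_elem n (s # x)"
    using assms(5,6) mult_cox_group[of "[s]" "aff_gens n" x "aff_matrix n"] x w by simp
  have jj: "jj b 1 = j" "ii b 1 = i" by (simp_all add: jj_def ii_def b)
  let ?h = "aff_elem n (h_word n j i)"
  have one: "?h = \<one>\<^bsub>aff_group n\<^esub> \<longleftrightarrow> pos j i = 1 \<and> j = n + 1"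
    by (rule h_word_trivial_iff[OF n rng])
  have ext: "extremal n ?h \<longleftrightarrow> pos j i \<noteq> 1 \<and> j \<noteq> n + 1"
    by (rule extremal_h_word_iff[OF n rng])
  note top = sign_block_top_moves[OF n sb[unfolded b], folded b, folded c_def]
  have len: "aff_length n (aff_elem n (block_word n d)) = block_len n d" if "sign_block n d" for d
    using aff_length_min_word[OF n block_word_min[OF n that]] length_block_word[OF that] by simp
  have dist: "aff_distinguished n (aff_elem n (block_word n d))" if "sign_block n d" for d
    using min_word_distinguished[OF n block_word_min[OF n that]] .
  have act: "sw\<^sub>a = aff_elem n (block_word n d)"
    if "sign_block n d" "block_vec n d = vec_act n s c"
      "block_len n d = block_len n b + 1 \<or> block_len n b = block_len n d + 1" for d
    using elem_act_block[OF n sb that(1) assms(5)] that(2,3) unfolding sw x_def c_def by blast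
  show ?thesis
  \<comment> \<open>The product is distinguished exactly when \<open>s\<close> moves the
    vector.\<close>
  proof (cases "gap n s c = 0")
    case True
    then show ?thesis
      using not_distinguished_fixed[OF n x(1) assms(5)] x(2) unfolding w sw by simp
  next
    case gap: False
    define case_a where "case_a \<longleftrightarrow> s = n + 1 \<and> pos j i = 1 \<and> j = n + 1"
    define case_b where "case_b \<longleftrightarrow> s = n + 1 \<and> pos j i \<noteq> 1 \<and> j \<noteq> n + 1"
    have "aff_distinguished n sw\<^sub>a \<and>
       (case_a \<and> affine_block n (tl b) \<and> sw\<^sub>a = aff_elem n (block_word n (tl b))
        \<or> case_b \<and> affine_block n ((n + 1, 0) # b) \<and> sw\<^sub>a = aff_elem n (block_word n ((n + 1, 0) # b))
        \<or> \<not> case_a \<and> \<not> case_b \<and>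
           (\<exists>b' r. affine_block n b' \<and> length b' = length b \<and>
              sw\<^sub>a = aff_elem n (block_word n b') \<and>
              differ_at b b' r \<and>
              (aff_length n sw\<^sub>a = aff_length n w\<^sub>a + 1 \<longrightarrow>
                 jj b' r + 1 = jj b r \<or> ii b' r = ii b r + 1) \<and>
              (aff_length n sw\<^sub>a + 1 = aff_length n w\<^sub>a \<longrightarrow>
                 jj b' r = jj b r + 1 \<or> ii b' r + 1 = ii b r)))"
    proof -
      consider (a) case_a | (b) case_b | (c) "\<not> case_a" "\<not> case_b" by blast
      then show ?thesis
      proof cases
        case a
        then have pj: "pos j i = 1" "j = n + 1" "s = n + 1" and i: "i = 0"
          using n by (auto simp: case_a_def pos_def split: if_splits)
        have t: "sign_block n t" "block_len n b = block_len n t + 1" using sb pj i by (auto simp: b)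
        have "sw\<^sub>a = aff_elem n (block_word n t)"
          using act[of t] t top(1)[OF pj(1,2)] pj(3) by simp
        then show ?thesis
          using a t dist[OF t(1)] affine_block_iff_sign_block[OF n, of t] by (simp add: b)
      next
        case b
        then have pj: "pos j i \<noteq> 1" "j \<noteq> n + 1" "s = n + 1" by (auto simp: case_b_def)
        have ends: "block_vec n b 1 \<le> 0" "0 \<le> block_vec n b (n + 1)" using top(2)[OF pj(1,2)] by (simp_all add: c_def)
        note C = sign_block_Cons_top[OF n sb ends]
        have "sw\<^sub>a = aff_elem n (block_word n ((n + 1, 0) # b))"
          using act[OF C(1)] C(2) pj(3) by (simp add: c_def)
        then show ?thesis
          using b dist[OF C(1)] C(1) affine_block_iff_sign_block[OF n, of "(n + 1, 0) # b"] by simp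
      next
        case c
        \<comment> \<open>For \<open>s = n + 1\<close>, the exclusion of both special cases means
          that exactly one end is occupied by an inserted entry.\<close>
        have moves: "block_moves n b (vec_act n s c) (gap n s c)"
        proof (cases "s = n + 1")
          case True
          then have "pos j i = 1 \<longleftrightarrow> j \<noteq> n + 1" using c by (auto simp: case_a_def case_b_def)
          then show ?thesis using top(3) True by simp
        next
          case False
          then show ?thesis using sign_block_moves[OF n sb] s by (simp add: c_def)
        qed
        have lw: "aff_length n w\<^sub>a = block_len n b" using len[OF sb] w by (simp add: x_def)
        show ?thesis
        proof (cases "0 < gap n s c")
          case True
          then obtain d where d: "sign_block n d" "block_vec n d = vec_act n s c" "raise b d"
            using moves by (auto simp: block_moves_def)
          have l: "block_len n d = block_len n b + 1" using block_len_raise[OF sb d(1,3)] .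
          have eq: "sw\<^sub>a = aff_elem n (block_word n d)" using act[OF d(1,2)] l by simp
          obtain r where "differ_at b d r" "jj d r + 1 = jj b r \<or> ii d r = ii b r + 1"
            using raise_differ_at[OF d(3)] by blast
          then show ?thesis
            using c d(1) eq dist[OF d(1)] len[OF d(1)] l lw raise_length[OF d(3)]
              affine_block_iff_sign_block[OF n, of d] by auto
        next
          case False
          then obtain d where d: "sign_block n d" "block_vec n d = vec_act n s c" "raise d b"
            using moves gap by (auto simp: block_moves_def)
          have l: "block_len n b = block_len n d + 1" using block_len_raise[OF d(1) sb d(3)] .
          have eq: "sw\<^sub>a = aff_elem n (block_word n d)" using act[OF d(1,2)] l by simp
          \<comment> \<open>The lengthening step leads from \<open>d\<close> to \<open>b\<close>, so
            the change of the entry is reversed.\<close>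
          obtain r where "differ_at b d r" "jj d r = jj b r + 1 \<or> ii d r + 1 = ii b r"
            using raise_differ_at[OF d(3)] by metis
          then show ?thesis
            using c d(1) eq dist[OF d(1)] len[OF d(1)] l lw raise_length[OF d(3)]
              affine_block_iff_sign_block[OF n, of d] by auto
        qed
      qed
    qed
    then show ?thesis
      unfolding Let_def jj one ext case_a_def case_b_def by blast
  qed
qed

end
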